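(* Let $\mu$ be an arbitrary Young diagram and let $D(\mu)$ be the set of Young diagrams $\lambda$ with $|\lambda|\le|\mu|$ and $\lambda\ne\mu$. Assume that the complex numbers $a_i$ ($i\in\mathbb Z$) are pairwise distinct. Then, as an element of $\Lambda$, $s_{\mu;a}$ is uniquely determined by the following three properties: first, its degree is less than or equal to $|\mu|$; second, its value at $(x(\mu);y(\mu))$ equals $$\prod_{(i,j)\in\mu}(a_{\mu_i-i+1}-a_{j-\mu'_j});$$ third, it vanishes at $(x(\lambda);y(\lambda))$ for all $\lambda\in D(\mu)$.
   Context: The base field is $\mathbb C$. $\Lambda=\mathbb C[\mathbf p_1,\mathbf p_2,\dots]$ is the algebra of symmetric functions, graded by $\deg\mathbf p_k=k$. Its elements $h_k$ are defined by $H(u)=1+\sum_{k\ge1}h_ku^{-k}=\exp\big(\sum_{k\ge1}\mathbf p_ku^{-k}/k\big)\in\Lambda[[u^{-1}]]$. For $f\in\Lambda$, $f(x;y)$ denotes the result of substituting $\mathbf p_k\mapsto\sum_ix_i^k+(-1)^{k-1}\sum_iy_i^k$. For $a=(a_i)_{i\in\mathbb Z}$, the elements $h_{k;a}\in\Lambda$ are defined by $1+\sum_{k\ge1}\frac{h_{k;a}}{(u-a_1)\cdots(u-a_k)}=H(u)$ in $\Lambda[[u^{-1}]]$, with $h_{0;a}=1$, $h_{k;a}=0$ for $k<0$. For $r\in\mathbb Z$, $(\tau^ra)_i=a_{i+r}$. The multiparameter Schur function is $s_{\mu;a}=\det[h_{\mu_i-i+j;\,\tau^{1-j}a}]$ (order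 any number $\ge\ell(\mu)$). Put $\widehat a_i=-a_{-i+1}$. For a Young diagram $\lambda$ with $D$ diagonal squares and Frobenius coordinates $P_i=\lambda_i-i$, $Q_i=\lambda'_i-i$ ($1\le i\le D$, $\lambda'$ the transposed diagram), set $x(\lambda)_i=a_{P_i+1}$, $y(\lambda)_i=\widehat a_{Q_i+1}$ for $1\le i\le D$, and $x(\lambda)_i=y(\lambda)_i=0$ for $i>D$. The value of $f\in\Lambda$ at $(x(\lambda);y(\lambda))$ is $f(x(\lambda);y(\lambda))$. The notation $(i,j)\in\mu$ means the square in row $i$, column $j$ belongs to $\mu$. *)

theory Defs
  imports
    "HOL-Library.Poly_Mapping"
    "HOL-Computational_Algebra.Formal_Power_Series"
    "Jordan_Normal_Form.Determinant"
begin

section \<open>The algebra of symmetric functions\<close>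

text \<open>
  The polynomial algebra over the complex numbers in the power sums \<open>p\<^sub>1, p\<^sub>2, \<dots>\<close>, as finitely
  supported functions on monomials (exponent vectors). There is no \<open>p\<^sub>0\<close>: the index \<open>i\<close> of
  an exponent vector stands for the generator \<open>p\<^bsub>i+1\<^esub>\<close>.
\<close>

type_synonym sym_fun = "(nat \<Rightarrow>\<^sub>0 nat) \<Rightarrow>\<^sub>0 complex"

definition sym_const :: "complex \<Rightarrow> sym_fun" where
  "sym_const c = Poly_Mapping.single 0 c"

text \<open>Only meaningful for \<open>k \<ge> 1\<close>.\<close>

definition power_sum :: "nat \<Rightarrow> sym_fun" where
  "power_sum k = Poly_Mapping.single (Poly_Mapping.single (k - 1) 1) 1"

definition mono_degree :: "(nat \<Rightarrow>\<^sub>0 nat) \<Rightarrow> nat" where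
  "mono_degree m = (\<Sum>i\<in>Poly_Mapping.keys m. (i + 1) * Poly_Mapping.lookup m i)"

text \<open>The degree for the grading in which \<open>p\<^sub>k\<close> has degree \<open>k\<close>; the zero element gets degree 0.\<close>

definition sym_degree :: "sym_fun \<Rightarrow> nat" where
  "sym_degree f = Max (insert 0 (mono_degree ` Poly_Mapping.keys f))"

text \<open>The image of \<open>f\<close> under the algebra homomorphism sending \<open>p\<^sub>k\<close> to \<open>\<phi> k\<close> for \<open>k \<ge> 1\<close>.\<close>

definition sym_subst :: "(nat \<Rightarrow> complex) \<Rightarrow> sym_fun \<Rightarrow> complex" where
  "sym_subst \<phi> f = (\<Sum>m\<in>Poly_Mapping.keys f. Poly_Mapping.lookup f m *
     (\<Prod>i\<in>Poly_Mapping.keys m. \<phi> (i + 1) ^ Poly_Mapping.lookup m i))"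

text \<open>
  The value \<open>f(x;y)\<close>, for finitely supported \<open>x\<close> and \<open>y\<close>; \<^const>\<open>Sum_any\<close> sums over all indices
  with a nonzero term.
\<close>

definition super_eval :: "(nat \<Rightarrow> complex) \<Rightarrow> (nat \<Rightarrow> complex) \<Rightarrow> sym_fun \<Rightarrow> complex" where
  "super_eval x y =
     sym_subst (\<lambda>k. Sum_any (\<lambda>i. x i ^ k) + (-1) ^ (k - 1) * Sum_any (\<lambda>i. y i ^ k))"

section \<open>Multiparameter complete symmetric functions\<close>

text \<open>
  Formal power series in \<open>u\<^sup>-\<^sup>1\<close> are represented by \<^typ>\<open>'a fps\<close>, with \<open>fps_X\<close> playing the role
  of \<open>u\<^sup>-\<^sup>1\<close>.
\<close>

definition fps_lift :: "complex fps \<Rightarrow> sym_fun fps" where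
  "fps_lift F = Abs_fps (\<lambda>n. sym_const (fps_nth F n))"

definition H_series :: "sym_fun fps" where
  "H_series = fps_compose (fps_lift (fps_exp 1))
     (Abs_fps (\<lambda>k. if k = 0 then 0 else sym_const (1 / of_nat k) * power_sum k))"

text \<open>The expansion in \<open>u\<^sup>-\<^sup>1\<close> of \<open>1 / (u - c) = u\<^sup>-\<^sup>1 / (1 - c u\<^sup>-\<^sup>1)\<close>.\<close>

definition inv_u_minus :: "complex \<Rightarrow> complex fps" where
  "inv_u_minus c = fps_X / (1 - fps_const c * fps_X)"

text \<open>Convergence of the series below is in the \<open>u\<^sup>-\<^sup>1\<close>-adic topology on formal power series.\<close>

definition is_multi_h :: "(int \<Rightarrow> complex) \<Rightarrow> (nat \<Rightarrow> sym_fun) \<Rightarrow> bool" where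
  "is_multi_h a h \<longleftrightarrow> h 0 = 1 \<and>
     (\<lambda>k. fps_const (h k) * fps_lift (\<Prod>i=1..k. inv_u_minus (a (int i)))) sums H_series"

lemma fps_nth_prod_inv_u_minus:
  "n \<le> k \<Longrightarrow> fps_nth (\<Prod>i=1..k. inv_u_minus (b i)) n = (if n = k then 1 else 0)"
proof (induction k arbitrary: n)
  case 0
  then show ?case by simp
next
  case (Suc k)
  define P where "P = (\<Prod>i=1..k. inv_u_minus (b i))"
  define V where "V = inverse (1 - fps_const (b (Suc k)) * fps_X)"
  have P0: "fps_nth P j = 0" if "j < k" for j
    using Suc.IH[of j] that by (simp add: P_def)
  have P1: "fps_nth P k = 1"
    using Suc.IH[of k] by (simp add: P_def)
  have V0: "fps_nth V 0 = 1"
    by (simp add: V_def)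
  have "inv_u_minus (b (Suc k)) = fps_X * V"
    by (simp add: inv_u_minus_def V_def fps_divide_unit)
  then have eq: "(\<Prod>i=1..Suc k. inv_u_minus (b i)) = fps_X * (P * V)"
    by (simp add: P_def mult_ac)
  show ?case
  proof (cases n)
    case 0
    then show ?thesis unfolding eq by simp
  next
    case (Suc m)
    then have m: "m \<le> k" using Suc.prems by simp
    have "fps_nth (P * V) m = (\<Sum>i=0..m. if i = k then 1 else 0)"
      unfolding fps_mult_nth
      by (rule sum.cong) (use m P0 P1 V0 in auto)
    also have "\<dots> = (if m = k then 1 else 0)"
      using m by auto
    finally show ?thesis
      unfolding eq using Suc by simp
  qed
qed

lemma fps_sums_iff:
  fixes f :: "nat \<Rightarrow> 'a :: ring_1 fps"
  assumes "\<And>k n. n < k \<Longrightarrow> fps_nth (f k) n = 0"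
  shows "f sums F \<longleftrightarrow> (\<forall>n. fps_nth F n = (\<Sum>k\<le>n. fps_nth (f k) n))"
proof -
  have stable: "fps_nth (\<Sum>k<N. f k) n = (\<Sum>k\<le>n. fps_nth (f k) n)" if "n < N" for n N
    unfolding fps_sum_nth
    by (rule sum.mono_neutral_right) (use that assms in auto)
  have "(\<forall>\<^sub>F N in sequentially. fps_nth (\<Sum>k<N. f k) n = fps_nth F n)
      \<longleftrightarrow> fps_nth F n = (\<Sum>k\<le>n. fps_nth (f k) n)" for n
  proof
    assume "\<forall>\<^sub>F N in sequentially. fps_nth (\<Sum>k<N. f k) n = fps_nth F n"
    then obtain N0 where "\<And>N. N \<ge> N0 \<Longrightarrow> fps_nth (\<Sum>k<N. f k) n = fps_nth F n"
      by (auto simp: eventually_sequentially)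
    from this[of "max N0 (Suc n)"] stable[of n "max N0 (Suc n)"]
    show "fps_nth F n = (\<Sum>k\<le>n. fps_nth (f k) n)" by simp
  next
    assume "fps_nth F n = (\<Sum>k\<le>n. fps_nth (f k) n)"
    then show "\<forall>\<^sub>F N in sequentially. fps_nth (\<Sum>k<N. f k) n = fps_nth F n"
      using stable unfolding eventually_sequentially by (metis Suc_le_eq)
  qed
  then show ?thesis
    unfolding sums_def tendsto_fps_iff by simp
qed

lemma ex1_multi_h: "\<exists>!h. is_multi_h a h"
proof -
  define G where "G k = fps_lift (\<Prod>i=1..k. inv_u_minus (a (int i)))" for k
  have G0: "fps_nth (G k) n = 0" if "n < k" for k n
    using fps_nth_prod_inv_u_minus[of n k "\<lambda>i. a (int i)"] that
    by (simp add: G_def fps_lift_def sym_const_def)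
  have G1: "fps_nth (G n) n = 1" for n
    using fps_nth_prod_inv_u_minus[of n n "\<lambda>i. a (int i)"]
    by (simp add: G_def fps_lift_def sym_const_def)
  have H0: "fps_nth H_series 0 = 1"
    by (simp add: H_series_def fps_lift_def sym_const_def)
  have iff: "is_multi_h a h \<longleftrightarrow>
      (\<forall>n. h n = fps_nth H_series n - (\<Sum>k<n. h k * fps_nth (G k) n))" for h
  proof -
    have "(\<lambda>k. fps_const (h k) * G k) sums H_series \<longleftrightarrow>
        (\<forall>n. fps_nth H_series n = (\<Sum>k\<le>n. h k * fps_nth (G k) n))"
      using fps_sums_iff[of "\<lambda>k. fps_const (h k) * G k" H_series] G0 by simp
    also have "\<dots> \<longleftrightarrow> (\<forall>n. h n = fps_nth H_series n - (\<Sum>k<n. h k * fps_nth (G k) n))"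
    proof (intro all_cong1)
      fix n
      have "(\<Sum>k\<le>n. h k * fps_nth (G k) n) = (\<Sum>k<n. h k * fps_nth (G k) n) + h n"
        by (simp add: lessThan_Suc_atMost[symmetric] G1)
      then show "fps_nth H_series n = (\<Sum>k\<le>n. h k * fps_nth (G k) n) \<longleftrightarrow>
          h n = fps_nth H_series n - (\<Sum>k<n. h k * fps_nth (G k) n)"
        by auto
    qed
    finally have A: "(\<lambda>k. fps_const (h k) * G k) sums H_series \<longleftrightarrow>
        (\<forall>n. h n = fps_nth H_series n - (\<Sum>k<n. h k * fps_nth (G k) n))" .
    have "h 0 = 1" if "\<forall>n. h n = fps_nth H_series n - (\<Sum>k<n. h k * fps_nth (G k) n)"
      using spec[OF that, of 0] H0 by simp
    then show ?thesis
      unfolding is_multi_h_def G_def[symmetric] A by blast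
  qed
  define R where "R h n = fps_nth H_series n - (\<Sum>k<n. h k * fps_nth (G k) n)"
    for h :: "nat \<Rightarrow> sym_fun" and n
  have adm: "adm_wf less_than R"
    unfolding adm_wf_def R_def by (auto intro!: sum.cong)
  have ex: "wfrec less_than R n = R (wfrec less_than R) n" for n
    using wfrec_fixpoint[OF wf_less_than adm] by metis
  show ?thesis
  proof (rule ex1I)
    show "is_multi_h a (wfrec less_than R)"
      unfolding iff R_def[symmetric] using ex by blast
  next
    fix h
    assume h: "is_multi_h a h"
    have "h n = wfrec less_than R n" for n
    proof (induction n rule: less_induct)
      case (less n)
      have "h n = R h n"
        using h unfolding iff R_def by blast
      also have "\<dots> = R (wfrec less_than R) n"
        using less.IH by (simp add: R_def[of h] R_def[of "wfrec less_than R"])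
      finally show ?case using ex[of n] by simp
    qed
    then show "h = wfrec less_than R" by blast
  qed
qed

definition multi_h :: "(int \<Rightarrow> complex) \<Rightarrow> int \<Rightarrow> sym_fun" where
  "multi_h a k = (if k < 0 then 0 else (THE h. is_multi_h a h) (nat k))"

definition shift :: "int \<Rightarrow> (int \<Rightarrow> complex) \<Rightarrow> int \<Rightarrow> complex" where
  "shift r a = (\<lambda>i. a (i + r))"

section \<open>Young diagrams\<close>

text \<open>A diagram is the set of its squares \<open>(i, j)\<close> (row, column), with rows and columns counted from 1.\<close>

definition young_diagram :: "(nat \<times> nat) set \<Rightarrow> bool" where
  "young_diagram \<mu> \<longleftrightarrow> finite \<mu> \<and> (\<forall>(i, j)\<in>\<mu>. 1 \<le> i \<and> 1 \<le> j \<and>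
     (\<forall>i' j'. 1 \<le> i' \<and> i' \<le> i \<and> 1 \<le> j' \<and> j' \<le> j \<longrightarrow> (i', j') \<in> \<mu>))"

text \<open>\<open>row_len \<mu> i\<close> is \<open>\<mu>\<^sub>i\<close>, \<open>col_len \<mu> j\<close> is \<open>\<mu>'\<^sub>j\<close>, and \<open>card \<mu>\<close> is \<open>|\<mu>|\<close>.\<close>

definition row_len :: "(nat \<times> nat) set \<Rightarrow> nat \<Rightarrow> nat" where
  "row_len \<mu> i = card {j. (i, j) \<in> \<mu>}"

definition col_len :: "(nat \<times> nat) set \<Rightarrow> nat \<Rightarrow> nat" where
  "col_len \<mu> j = card {i. (i, j) \<in> \<mu>}"

definition num_rows :: "(nat \<times> nat) set \<Rightarrow> nat" where
  "num_rows \<mu> = card {i. \<exists>j. (i, j) \<in> \<mu>}"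

definition diag_len :: "(nat \<times> nat) set \<Rightarrow> nat" where
  "diag_len \<mu> = card {i. (i, i) \<in> \<mu>}"

text \<open>
  The sequences \<open>x(\<nu>)\<close> and \<open>y(\<nu>)\<close>, indexed from 1; the unused entry at index 0 is set to 0, so
  that it does not contribute to power sums.
\<close>

definition dual_params :: "(int \<Rightarrow> complex) \<Rightarrow> int \<Rightarrow> complex" where
  "dual_params a i = - a (- i + 1)"

definition frob_x :: "(int \<Rightarrow> complex) \<Rightarrow> (nat \<times> nat) set \<Rightarrow> nat \<Rightarrow> complex" where
  "frob_x a \<nu> i = (if 1 \<le> i \<and> i \<le> diag_len \<nu>
     then a ((int (row_len \<nu> i) - int i) + 1) else 0)"

definition frob_y :: "(int \<Rightarrow> complex) \<Rightarrow> (nat \<times> nat) set \<Rightarrow> nat \<Rightarrow> complex" where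
  "frob_y a \<nu> i = (if 1 \<le> i \<and> i \<le> diag_len \<nu>
     then dual_params a ((int (col_len \<nu> i) - int i) + 1) else 0)"

definition diagram_eval :: "(int \<Rightarrow> complex) \<Rightarrow> (nat \<times> nat) set \<Rightarrow> sym_fun \<Rightarrow> complex" where
  "diagram_eval a \<nu> f = super_eval (frob_x a \<nu>) (frob_y a \<nu>) f"

section \<open>Multiparameter Schur functions\<close>

text \<open>
  The determinant of order \<open>n\<close>, which is meant for any \<open>n \<ge> num_rows \<mu>\<close>. Matrix indices start at 0,
  so entry \<open>(i, j)\<close> below is the one in row \<open>i + 1\<close> and column \<open>j + 1\<close>: hence the shift by
  \<open>1 - (j + 1) = - j\<close>, while \<open>- (i + 1) + (j + 1) = - i + j\<close>.
\<close>

definition multi_schur :: "nat \<Rightarrow> (int \<Rightarrow> complex) \<Rightarrow> (nat \<times> nat) set \<Rightarrow> sym_fun" where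
  "multi_schur n a \<mu> = det (mat n n (\<lambda>(i, j).
     multi_h (shift (- int j) a) (int (row_len \<mu> (i + 1)) - int i + int j)))"

end

theory Submission
  imports Defs
begin

text \<open>
  Existence. Write \<open>u\<^sup>-\<^sup>1 = X\<close> and \<open>lin c = 1 - c X\<close>. Let \<open>\<nu>\<close> be a diagram with at most
  \<open>N\<close> rows, and let \<open>maya \<nu> t = \<nu>\<^bsub>t+1\<^esub> - t\<close> for \<open>t < N\<close>. In these coordinates the Frobenius form of
  \<open>H(u)\<close> at \<open>(x(\<nu>); y(\<nu>))\<close> becomes
  \<open>(\<Prod>t<N. lin (a (- t))) / (\<Prod>t<N. lin (a (maya \<nu> t)))\<close>, because the numbers \<open>maya \<nu> t\<close> and
  \<open>gap \<nu> j = j - \<nu>'\<^sub>j\<close> fill an interval of integers without overlap (\<open>gap_Un_maya\<close>). Moreover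
  \<open>h\<^bsub>k;a\<^esub>\<close> is the coefficient of \<open>X\<^sup>k\<close> in \<open>H(u) lin (a 1) \<dots> lin (a (k - 1))\<close> (\<open>multi_h_eq_nth\<close>).
  Together, the \<open>(i, j)\<close> entry of the determinant at \<open>\<nu>\<close> is the coefficient of \<open>u\<^sup>-\<^sup>1\<close> in
  \<open>q\<^sub>j(u) p\<^sub>i(u) / (\<Prod>t<N. (u - a (maya \<nu> t)))\<close>. Here \<open>q\<^sub>j\<close> is the product of the \<open>u - a\<^bsub>-t\<^esub>\<close>
  with \<open>t < j\<close>, and \<open>p\<^sub>i\<close> is the product of the \<open>u - a\<^sub>r\<close> with \<open>1 - N \<le> r < maya \<mu> i\<close>
  (\<open>multi_h_eval\<close>).

  The entries depend linearly on \<open>q\<^sub>j\<close>, which is monic of degree \<open>j\<close>. So the determinant does not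
  change when \<open>q\<^sub>j\<close> is replaced by the product of the \<open>u - a (maya \<nu> t)\<close> with \<open>t < j\<close>
  (\<open>det_newton_change\<close>). This cancels part of the denominator, and the entries become transparent.
  If \<open>maya \<mu> i > maya \<nu> k\<close>, the quotient in the entry \<open>(i, k)\<close> is a polynomial, so its coefficient
  of \<open>u\<^sup>-\<^sup>1\<close> is 0. If \<open>maya \<mu> i = maya \<nu> k\<close>, the quotient has a single simple pole, and the
  entry is the value of the remaining numerator there. Consequently the determinant has a large
  block of zeros unless \<open>\<mu> \<subseteq> \<nu>\<close>. For \<open>\<nu> = \<mu>\<close> it is triangular, and the product of its diagonal
  entries is the product over the squares of \<open>\<mu>\<close>, again by \<open>gap_Un_maya\<close>. The degree bound is
  that of \<open>h\<^bsub>k;a\<^esub>\<close>, summed along the terms of the determinant (\<open>deg_le_multi_schur\<close>).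

  Uniqueness. The difference of two solutions has degree at most \<open>|\<mu>|\<close> and vanishes at every
  diagram with at most \<open>|\<mu>|\<close> squares. Ordered by size, the values of the multiparameter Schur
  functions at these diagrams form a triangular matrix, whose diagonal is nonzero because \<open>a\<close> is
  injective. So these functions are linearly independent, and a nonzero element that vanishes at
  all these diagrams would be independent of them. The monomials of degree at most \<open>|\<mu>|\<close> in the power
  sums are no more numerous than these diagrams, as a monomial is a partition written by
  multiplicities; this leaves no room for a further independent element.
\<close>

section \<open>Young diagrams by rows and columns\<close>

text \<open>
  Rows, columns and the diagonal of a diagram are all sets of this kind; this turns the lengths
  \<open>row_len\<close>, \<open>col_len\<close> and \<open>diag_len\<close>, defined as cardinalities, into bounds on coordinates.
\<close>

lemma down_closed_eq_atLeastAtMost_card: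
  fixes A :: "nat set"
  assumes "finite A" and "\<And>i. i \<in> A \<Longrightarrow> 1 \<le> i"
    and "\<And>i j. i \<in> A \<Longrightarrow> 1 \<le> j \<Longrightarrow> j \<le> i \<Longrightarrow> j \<in> A"
  shows "A = {1..card A}"
proof (cases "A = {}")
  case False
  define m where "m = Max A"
  have m: "m \<in> A" "\<And>i. i \<in> A \<Longrightarrow> i \<le> m"
    using assms(1) False by (simp_all add: m_def)
  have "A = {1..m}"
  proof (intro equalityI subsetI)
    fix i assume "i \<in> A" then show "i \<in> {1..m}" using m(2) assms(2) by simp
  next
    fix i assume "i \<in> {1..m}" then show "i \<in> A" using m(1) assms(3) by simp
  qed
  then show ?thesis by simp
qed simp

context
  fixes \<mu> :: "(nat \<times> nat) set"
  assumes \<mu>: "young_diagram \<mu>"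
begin

lemma diagram_finite: "finite \<mu>"
  using \<mu> by (simp add: young_diagram_def)

lemma diagram_ge_1: "(i, j) \<in> \<mu> \<Longrightarrow> 1 \<le> i \<and> 1 \<le> j"
  using \<mu> by (auto simp: young_diagram_def)

lemma diagram_down: "(i, j) \<in> \<mu> \<Longrightarrow> 1 \<le> i' \<Longrightarrow> i' \<le> i \<Longrightarrow> 1 \<le> j' \<Longrightarrow> j' \<le> j \<Longrightarrow> (i', j') \<in> \<mu>"
  using \<mu> unfolding young_diagram_def by blast

lemma row_set_eq: "{j. (i, j) \<in> \<mu>} = {1..row_len \<mu> i}"
  unfolding row_len_def
proof (rule down_closed_eq_atLeastAtMost_card)
  have "{j. (i, j) \<in> \<mu>} \<subseteq> snd ` \<mu>" by force
  then show "finite {j. (i, j) \<in> \<mu>}" by (rule finite_subset) (simp add: diagram_finite)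
next
  fix k assume "k \<in> {j. (i, j) \<in> \<mu>}"
  then show "1 \<le> k" using diagram_ge_1[of i k] by simp
next
  fix k k' assume "k \<in> {j. (i, j) \<in> \<mu>}" "1 \<le> k'" "k' \<le> k"
  then show "k' \<in> {j. (i, j) \<in> \<mu>}"
    using diagram_ge_1[of i k] diagram_down[of i k i k'] by simp
qed

lemma col_set_eq: "{i. (i, j) \<in> \<mu>} = {1..col_len \<mu> j}"
  unfolding col_len_def
proof (rule down_closed_eq_atLeastAtMost_card)
  have "{i. (i, j) \<in> \<mu>} \<subseteq> fst ` \<mu>" by force
  then show "finite {i. (i, j) \<in> \<mu>}" by (rule finite_subset) (simp add: diagram_finite)
next
  fix k assume "k \<in> {i. (i, j) \<in> \<mu>}"
  then show "1 \<le> k" using diagram_ge_1[of k j] by simp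
next
  fix k k' assume "k \<in> {i. (i, j) \<in> \<mu>}" "1 \<le> k'" "k' \<le> k"
  then show "k' \<in> {i. (i, j) \<in> \<mu>}"
    using diagram_ge_1[of k j] diagram_down[of k j k' j] by simp
qed

lemma in_diagram_iff_row: "(i, j) \<in> \<mu> \<longleftrightarrow> 1 \<le> j \<and> j \<le> row_len \<mu> i"
proof -
  have "(i, j) \<in> \<mu> \<longleftrightarrow> j \<in> {j. (i, j) \<in> \<mu>}" by simp
  then show ?thesis by (simp only: row_set_eq atLeastAtMost_iff)
qed

lemma in_diagram_iff_col: "(i, j) \<in> \<mu> \<longleftrightarrow> 1 \<le> i \<and> i \<le> col_len \<mu> j"
proof -
  have "(i, j) \<in> \<mu> \<longleftrightarrow> i \<in> {i. (i, j) \<in> \<mu>}" by simp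
  then show ?thesis by (simp only: col_set_eq atLeastAtMost_iff)
qed

lemma row_len_col_len: "1 \<le> i \<Longrightarrow> 1 \<le> j \<Longrightarrow> j \<le> row_len \<mu> i \<longleftrightarrow> i \<le> col_len \<mu> j"
  using in_diagram_iff_row in_diagram_iff_col by blast

lemma row_len_antimono:
  assumes "1 \<le> i" "i \<le> i'" shows "row_len \<mu> i' \<le> row_len \<mu> i"
proof (cases "row_len \<mu> i' = 0")
  case False
  then have "i' \<le> col_len \<mu> (row_len \<mu> i')"
    using row_len_col_len[of i' "row_len \<mu> i'"] assms by simp
  then show ?thesis
    using row_len_col_len[of i "row_len \<mu> i'"] assms False by simp
qed simp

lemma col_len_antimono:
  assumes "1 \<le> j" "j \<le> j'" shows "col_len \<mu> j' \<le> col_len \<mu> j"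
proof (cases "col_len \<mu> j' = 0")
  case False
  then have "j' \<le> row_len \<mu> (col_len \<mu> j')"
    using row_len_col_len[of "col_len \<mu> j'" j'] assms by simp
  then show ?thesis
    using row_len_col_len[of "col_len \<mu> j'" j] assms False by simp
qed simp

lemma num_rows_eq_col_len: "num_rows \<mu> = col_len \<mu> 1"
proof -
  have "(i, 1) \<in> \<mu>" if "(i, j) \<in> \<mu>" for i j
    using diagram_ge_1[OF that] diagram_down[OF that, of i 1] by simp
  then have "{i. \<exists>j. (i, j) \<in> \<mu>} = {i. (i, 1) \<in> \<mu>}" by auto
  then show ?thesis by (simp add: num_rows_def col_len_def)
qed

lemma row_len_eq_0_iff: "1 \<le> i \<Longrightarrow> row_len \<mu> i = 0 \<longleftrightarrow> num_rows \<mu> < i"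
  using row_len_col_len[of i 1] by (auto simp: num_rows_eq_col_len)

lemma col_len_le_num_rows: "1 \<le> j \<Longrightarrow> col_len \<mu> j \<le> num_rows \<mu>"
  using col_len_antimono[of 1 j] by (simp add: num_rows_eq_col_len)

lemma diag_set_eq: "{i. (i, i) \<in> \<mu>} = {1..diag_len \<mu>}"
  unfolding diag_len_def
proof (rule down_closed_eq_atLeastAtMost_card)
  have "{i. (i, i) \<in> \<mu>} \<subseteq> fst ` \<mu>" by force
  then show "finite {i. (i, i) \<in> \<mu>}" by (rule finite_subset) (simp add: diagram_finite)
next
  fix k assume "k \<in> {i. (i, i) \<in> \<mu>}"
  then show "1 \<le> k" using diagram_ge_1[of k k] by simp
next
  fix k k' assume "k \<in> {i. (i, i) \<in> \<mu>}" "1 \<le> k'" "k' \<le> k"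
  then show "k' \<in> {i. (i, i) \<in> \<mu>}"
    using diagram_ge_1[of k k] diagram_down[of k k k' k'] by simp
qed

lemma diag_len_iff_row: "1 \<le> i \<Longrightarrow> i \<le> diag_len \<mu> \<longleftrightarrow> i \<le> row_len \<mu> i"
proof -
  assume "1 \<le> i"
  moreover have "i \<in> {i. (i, i) \<in> \<mu>} \<longleftrightarrow> 1 \<le> i \<and> i \<le> row_len \<mu> i"
    by (simp only: mem_Collect_eq in_diagram_iff_row)
  ultimately show ?thesis by (simp add: diag_set_eq)
qed

lemma diag_len_iff_col: "1 \<le> i \<Longrightarrow> i \<le> diag_len \<mu> \<longleftrightarrow> i \<le> col_len \<mu> i"
proof -
  assume "1 \<le> i"
  moreover have "i \<in> {i. (i, i) \<in> \<mu>} \<longleftrightarrow> 1 \<le> i \<and> i \<le> col_len \<mu> i"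
    by (simp only: mem_Collect_eq in_diagram_iff_col)
  ultimately show ?thesis by (simp add: diag_set_eq)
qed

lemma diag_len_le_num_rows: "diag_len \<mu> \<le> num_rows \<mu>"
  using diag_len_iff_col[of "diag_len \<mu>"] col_len_le_num_rows[of "diag_len \<mu>"]
  by (cases "diag_len \<mu> = 0") auto

lemma diagram_eq_Sigma:
  assumes "num_rows \<mu> \<le> N"
  shows "\<mu> = (SIGMA i:{1..N}. {1..row_len \<mu> i})"
proof -
  have "i \<in> {1..N}" if "(i, j) \<in> \<mu>" for i j
    using that row_len_eq_0_iff[of i] diagram_ge_1[OF that] in_diagram_iff_row[of i j] assms by auto
  then have "(i, j) \<in> \<mu> \<longleftrightarrow> i \<in> {1..N} \<and> j \<in> {1..row_len \<mu> i}" for i j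
    by (metis in_diagram_iff_row atLeastAtMost_iff)
  then show ?thesis by auto
qed

lemma card_diagram:
  assumes "num_rows \<mu> \<le> N"
  shows "card \<mu> = (\<Sum>i<N. row_len \<mu> (i + 1))"
proof -
  have "card \<mu> = card (SIGMA i:{1..N}. {1..row_len \<mu> i})"
    by (simp only: diagram_eq_Sigma[OF assms, symmetric])
  also have "\<dots> = (\<Sum>i\<in>{1..N}. row_len \<mu> i)" by simp
  also have "\<dots> = (\<Sum>i<N. row_len \<mu> (i + 1))"
    by (rule sum.reindex_bij_witness[of _ Suc "\<lambda>i. i - 1"]) auto
  finally show ?thesis .
qed

lemma prod_diagram:
  assumes "num_rows \<mu> \<le> N"
  shows "(\<Prod>(i, j)\<in>\<mu>. f i j) = (\<Prod>i<N. \<Prod>j\<in>{1..row_len \<mu> (i + 1)}. f (i + 1) j)"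
proof -
  have "(\<Prod>(i, j)\<in>\<mu>. f i j) = (\<Prod>(i, j)\<in>(SIGMA i:{1..N}. {1..row_len \<mu> i}). f i j)"
    by (simp only: diagram_eq_Sigma[OF assms, symmetric])
  also have "\<dots> = (\<Prod>i\<in>{1..N}. \<Prod>j\<in>{1..row_len \<mu> i}. f i j)"
    by (rule prod.Sigma[symmetric]) auto
  also have "\<dots> = (\<Prod>i<N. \<Prod>j\<in>{1..row_len \<mu> (i + 1)}. f (i + 1) j)"
    by (rule prod.reindex_bij_witness[of _ Suc "\<lambda>i. i - 1"]) auto
  finally show ?thesis .
qed

end

section \<open>The Maya diagram of a partition\<close>

text \<open>
  The shift is chosen so that \<open>a (maya \<mu> t)\<close> is the parameter with index \<open>\<mu>\<^sub>i - i + 1\<close> of row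
  \<open>i = t + 1\<close>. All rows count here, including the empty ones.
\<close>

definition maya :: "(nat \<times> nat) set \<Rightarrow> nat \<Rightarrow> int" where
  "maya \<mu> t = int (row_len \<mu> (t + 1)) - int t"

lemma maya_strict_antimono: "young_diagram \<mu> \<Longrightarrow> s < t \<Longrightarrow> maya \<mu> t < maya \<mu> s"
  using row_len_antimono[of \<mu> "s + 1" "t + 1"] by (simp add: maya_def)

lemma inj_on_maya: "young_diagram \<mu> \<Longrightarrow> inj_on (maya \<mu>) A"
  by (rule inj_onI) (metis maya_strict_antimono less_irrefl linorder_neqE_nat)

text \<open>
  The holes of the Maya diagram: traversing the boundary of \<open>\<mu>\<close>, the numbers \<open>maya \<mu> t\<close> label the
  vertical steps and the numbers \<open>gap \<mu> j\<close> the horizontal ones. If \<open>j\<close> is at most the diagonal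
  length, then \<open>gap \<mu> j = - Q\<^sub>j\<close>.
\<close>

definition gap :: "(nat \<times> nat) set \<Rightarrow> nat \<Rightarrow> int" where
  "gap \<mu> j = int j - int (col_len \<mu> j)"

lemma inj_on_gap: "young_diagram \<mu> \<Longrightarrow> inj_on (gap \<mu>) {1..c}"
proof (rule linorder_inj_onI')
  fix i j assume "young_diagram \<mu>" "i \<in> {1..c}" "i < j"
  then show "gap \<mu> i \<noteq> gap \<mu> j"
    using col_len_antimono[of \<mu> i j] by (simp add: gap_def)
qed

text \<open>
  Compare \<open>gap \<mu> j\<close> with \<open>maya \<mu> t\<close> according to whether the square in row \<open>t + 1\<close> and column \<open>j\<close> belongs
  to \<open>\<mu>\<close>: if it does, then \<open>j \<le> \<mu>\<^bsub>t+1\<^esub>\<close> and \<open>\<mu>'\<^sub>j > t\<close>, so the gap is smaller; otherwise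
  \<open>j > \<mu>\<^bsub>t+1\<^esub>\<close> and \<open>\<mu>'\<^sub>j \<le> t\<close>, so it is larger.
\<close>

lemma gap_neq_maya:
  assumes "young_diagram \<mu>" "1 \<le> j" shows "gap \<mu> j \<noteq> maya \<mu> t"
  using row_len_col_len[OF assms(1), of "t + 1" j] assms(2)
  by (cases "j \<le> row_len \<mu> (t + 1)") (auto simp: gap_def maya_def)

text \<open>
  The hypotheses say that the point between rows \<open>s\<close> and \<open>s + 1\<close> and columns \<open>c\<close> and \<open>c + 1\<close> lies on
  the boundary of \<open>\<mu>\<close>. The lattice path that follows the boundary down to row \<open>N\<close> has \<open>c\<close> horizontal
  and \<open>N - s\<close> vertical steps, with consecutive labels; a count of elements replaces the path.
  Two boundary points matter below: the end of a row, and the point where the boundary crosses the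
  diagonal.
\<close>

lemma gap_Un_maya:
  assumes \<mu>: "young_diagram \<mu>" and N: "num_rows \<mu> \<le> N" "s \<le> N"
    and col: "\<And>j. 1 \<le> j \<Longrightarrow> j \<le> c \<Longrightarrow> s \<le> col_len \<mu> j"
    and row: "row_len \<mu> (s + 1) \<le> c"
  shows "gap \<mu> ` {1..c} \<union> maya \<mu> ` {s..<N} = {1 - int N..int c - int s}"
    and "gap \<mu> ` {1..c} \<inter> maya \<mu> ` {s..<N} = {}"
proof -
  show disj: "gap \<mu> ` {1..c} \<inter> maya \<mu> ` {s..<N} = {}"
    using gap_neq_maya[OF \<mu>] by fastforce
  show "gap \<mu> ` {1..c} \<union> maya \<mu> ` {s..<N} = {1 - int N..int c - int s}"
  proof (rule card_subset_eq)
    show "gap \<mu> ` {1..c} \<union> maya \<mu> ` {s..<N} \<subseteq> {1 - int N..int c - int s}"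
    proof safe
      fix j assume "j \<in> {1..c}"
      then show "gap \<mu> j \<in> {1 - int N..int c - int s}"
        using col[of j] col_len_le_num_rows[OF \<mu>, of j] N by (auto simp: gap_def)
    next
      fix t assume "t \<in> {s..<N}"
      then show "maya \<mu> t \<in> {1 - int N..int c - int s}"
        using row row_len_antimono[OF \<mu>, of "s + 1" "t + 1"] by (auto simp: maya_def)
    qed
    have "card (gap \<mu> ` {1..c} \<union> maya \<mu> ` {s..<N}) = c + (N - s)"
      using disj inj_on_gap[OF \<mu>, of c] inj_on_maya[OF \<mu>, of "{s..<N}"]
      by (simp add: card_Un_disjoint card_image)
    then show "card (gap \<mu> ` {1..c} \<union> maya \<mu> ` {s..<N}) = card {1 - int N..int c - int s}"
      using N by simp
  qed simp
qed

section \<open>Products of linear factors as power series\<close>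

text \<open>
  The factor \<open>u - c\<close> in the variable \<open>X = u\<^sup>-\<^sup>1\<close>, divided by \<open>u\<close>. A product of \<open>d\<close> factors \<open>u - c\<^sub>i\<close>
  becomes \<open>X\<^bsup>-d\<^esup>\<close> times a product of factors \<open>lin\<close>, so coefficients of \<open>u\<^sup>-\<^sup>1\<close> turn
  into coefficients whose index depends on the degrees.
\<close>

definition lin :: "complex \<Rightarrow> complex fps" where
  "lin c = 1 - fps_const c * fps_X"

lemma lin_nth_0 [simp]: "fps_nth (lin c) 0 = 1"
  by (simp add: lin_def)

lemma prod_lin_nth_0 [simp]: "fps_nth (\<Prod>i\<in>S. lin (c i)) 0 = 1"
  by (induction S rule: infinite_finite_induct) auto

lemma prod_lin_mult_inverse [simp]:
  "(\<Prod>i\<in>S. lin (c i)) * inverse (\<Prod>i\<in>S. lin (c i)) = 1"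
  by (rule inverse_mult_eq_1') simp

lemma lin_mult_nth_Suc: "fps_nth (lin c * F) (Suc k) = fps_nth F (Suc k) - c * fps_nth F k"
  
proof -
  have "lin c * F = F - fps_const c * (fps_X * F)"
    by (simp add: lin_def algebra_simps)
  then show ?thesis by simp
qed

lemma prod_lin_nth_eq_0:
  assumes "finite S" "card S < k" shows "fps_nth (\<Prod>i\<in>S. lin (c i)) k = 0"
  using assms
proof (induction S arbitrary: k rule: finite_induct)
  case empty then show ?case by simp
next
  case (insert s S)
  then obtain k' where "k = Suc k'" by (cases k) auto
  with insert show ?case by (simp add: lin_mult_nth_Suc)
qed

text \<open>
  If \<open>q\<close> is the product of the \<open>u - c\<^sub>i\<close>, this is the coefficient of \<open>u\<^sup>-\<^sup>1\<close> in \<open>q(u) / (u - b)\<close>, that is \<open>q(b)\<close>.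
  For one more factor, \<open>(u - c) / (u - b) = 1 + (b - c) / (u - b)\<close>.
\<close>

lemma prod_lin_divide_lin_nth_card:
  assumes "finite S"
  shows "fps_nth ((\<Prod>i\<in>S. lin (c i)) * inverse (lin b)) (card S) = (\<Prod>i\<in>S. b - c i)"
  using assms
proof (induction S rule: finite_induct)
  case empty then show ?case by simp
next
  case (insert s S)
  define W where "W = (\<Prod>i\<in>S. lin (c i))"
  have "lin (c s) * inverse (lin b) = (lin b + fps_const (b - c s) * fps_X) * inverse (lin b)"
    by (simp add: lin_def algebra_simps flip: fps_const_sub)
  also have "\<dots> = 1 + fps_const (b - c s) * fps_X * inverse (lin b)"
    by (simp add: distrib_right inverse_mult_eq_1')
  finally have eq: "lin (c s) * inverse (lin b) = 1 + fps_const (b - c s) * fps_X * inverse (lin b)" .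
  have "(\<Prod>i\<in>insert s S. lin (c i)) * inverse (lin b) = W * (lin (c s) * inverse (lin b))"
    using insert by (simp add: W_def mult_ac)
  also have "\<dots> = W + fps_const (b - c s) * (fps_X * (W * inverse (lin b)))"
    unfolding eq by (simp add: algebra_simps)
  finally have "(\<Prod>i\<in>insert s S. lin (c i)) * inverse (lin b)
      = W + fps_const (b - c s) * (fps_X * (W * inverse (lin b)))" .
  moreover have "fps_nth W (Suc (card S)) = 0"
    unfolding W_def by (rule prod_lin_nth_eq_0) (use insert in auto)
  ultimately show ?case
    using insert by (simp add: W_def)
qed

text \<open>
  The coefficients of the Newton polynomials with nodes \<open>c\<close> with respect to those with nodes \<open>b\<close>;
  the recursion comes from \<open>u - c\<^sub>j = (u - b\<^sub>k) + (b\<^sub>k - c\<^sub>j)\<close>.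
\<close>

fun newton_coeff :: "(nat \<Rightarrow> complex) \<Rightarrow> (nat \<Rightarrow> complex) \<Rightarrow> nat \<Rightarrow> nat \<Rightarrow> complex" where
  "newton_coeff c b 0 k = (if k = 0 then 1 else 0)"
| "newton_coeff c b (Suc j) 0 = (b 0 - c j) * newton_coeff c b j 0"
| "newton_coeff c b (Suc j) (Suc k) =
     newton_coeff c b j k + (b (Suc k) - c j) * newton_coeff c b j (Suc k)"

lemma newton_coeff_above: "j < k \<Longrightarrow> newton_coeff c b j k = 0"
  by (induction c b j k rule: newton_coeff.induct) auto

lemma newton_coeff_diag: "newton_coeff c b j j = 1"
  by (induction j) (auto simp: newton_coeff_above)

text \<open>
  The powers of \<open>X\<close> make up for the different degrees of the Newton polynomials.
\<close>

lemma newton_interpolation: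
  "(\<Prod>t<j. lin (c t)) =
     (\<Sum>k\<le>j. fps_const (newton_coeff c b j k) * (fps_X ^ (j - k) * (\<Prod>t<k. lin (b t))))"
proof (induction j)
  case 0 show ?case by simp
next
  case (Suc j)
  define T where "T k = fps_const (newton_coeff c b j k)" for k
  define n where "n k = (\<Prod>t<k. lin (b t))" for k
  have step: "lin (c j) * n k = n (Suc k) + fps_const (b k - c j) * (fps_X * n k)" for k
    by (simp add: n_def lin_def algebra_simps flip: fps_const_sub)
  have "(\<Prod>t<Suc j. lin (c t)) = (\<Sum>k\<le>j. T k * (fps_X ^ (j - k) * (lin (c j) * n k)))"
    by (simp add: Suc.IH T_def n_def sum_distrib_left mult_ac)
  also have "\<dots> = (\<Sum>k\<le>j. T k * (fps_X ^ (j - k) * n (Suc k)))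
      + (\<Sum>k\<le>j. T k * fps_const (b k - c j) * (fps_X ^ (Suc j - k) * n k))"
    unfolding sum.distrib[symmetric]
    by (rule sum.cong) (simp_all only: step atMost_iff Suc_diff_le, simp_all add: algebra_simps)
  also have "(\<Sum>k\<le>j. T k * fps_const (b k - c j) * (fps_X ^ (Suc j - k) * n k))
      = (\<Sum>k\<le>Suc j. T k * fps_const (b k - c j) * (fps_X ^ (Suc j - k) * n k))"
    by (simp add: T_def newton_coeff_above)
  also have "\<dots> = T 0 * fps_const (b 0 - c j) * (fps_X ^ Suc j * n 0)
      + (\<Sum>k\<le>j. T (Suc k) * fps_const (b (Suc k) - c j) * (fps_X ^ (j - k) * n (Suc k)))"
    by (subst sum.atMost_Suc_shift) simp
  finally have "(\<Prod>t<Suc j. lin (c t)) = T 0 * fps_const (b 0 - c j) * (fps_X ^ Suc j * n 0)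
      + (\<Sum>k\<le>j. (T k + T (Suc k) * fps_const (b (Suc k) - c j)) * (fps_X ^ (j - k) * n (Suc k)))"
    by (simp add: sum.distrib algebra_simps)
  also have "\<dots> = (\<Sum>k\<le>Suc j. fps_const (newton_coeff c b (Suc j) k) * (fps_X ^ (Suc j - k) * n k))"
    by (subst sum.atMost_Suc_shift) (simp add: T_def mult.commute flip: fps_const_add fps_const_mult)
  finally show ?case by (simp add: n_def)
qed

lemma prod_lin_quotient:
  assumes "finite R" "inj_on f I" "f ` I \<subseteq> R"
  shows "(\<Prod>r\<in>R. lin (a r)) * inverse (\<Prod>t\<in>I. lin (a (f t))) = (\<Prod>r\<in>R - f ` I. lin (a r))"
proof -
  have "(\<Prod>r\<in>R. lin (a r)) = (\<Prod>r\<in>R - f ` I. lin (a r)) * (\<Prod>r\<in>f ` I. lin (a r))"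
    by (rule prod.subset_diff) (use assms in auto)
  also have "(\<Prod>r\<in>f ` I. lin (a r)) = (\<Prod>t\<in>I. lin (a (f t)))"
    using assms(2) by (simp add: prod.reindex)
  finally show ?thesis by (simp add: mult.assoc)
qed

section \<open>Change of Newton basis in a determinant\<close>

text \<open>
  Negative indices occur in the determinant, where the convention \<open>h\<^bsub>k;a\<^esub> = 0\<close> for \<open>k < 0\<close> corresponds
  to vanishing coefficients.
\<close>

definition int_nth :: "'a :: zero fps \<Rightarrow> int \<Rightarrow> 'a" where
  "int_nth F k = (if k < 0 then 0 else fps_nth F (nat k))"

lemma int_nth_sum: "int_nth (\<Sum>i\<in>I. F i) k = (\<Sum>i\<in>I. int_nth (F i) k)"
  by (simp add: int_nth_def fps_sum_nth)

lemma int_nth_const_mult: "int_nth (fps_const c * F) k = c * int_nth F k"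
  for c :: "'a :: semiring_1"
  by (simp add: int_nth_def)

lemma int_nth_X_power_mult: "int_nth (fps_X ^ s * F) k = int_nth F (k - int s)"
  for F :: "'a :: semiring_1 fps"
proof -
  have "nat k - s = nat (k - int s)" by simp
  then show ?thesis
    by (auto simp: int_nth_def fps_X_power_mult_nth)
qed

text \<open>
  The coefficients of the left-hand columns in the right-hand ones form a triangular matrix with
  units on the diagonal. On the right, \<open>\<Prod>t<k. lin (b t)\<close> has cancelled against the denominator.
\<close>

lemma det_newton_change:
  "det (mat N N (\<lambda>(i, j). int_nth ((\<Prod>t<j. lin (c t)) * F i * inverse (\<Prod>t<N. lin (b t))) (m i + int j)))
   = det (mat N N (\<lambda>(i, k). int_nth (F i * inverse (\<Prod>t\<in>{k..<N}. lin (b t))) (m i + int k)))"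
    (is "det ?M = det ?A")
proof -
  \<comment> \<open>Transposed, so that the matrix of coefficients acts on columns from the right.\<close>
  define T where "T = mat N N (\<lambda>(k, j). newton_coeff c b j k)"
  define D where "D = (\<Prod>t<N. lin (b t))"
  have entry: "int_nth ((\<Prod>t<j. lin (c t)) * F i * inverse D) (m i + int j)
      = (\<Sum>k<N. int_nth (F i * inverse (\<Prod>t\<in>{k..<N}. lin (b t))) (m i + int k) * newton_coeff c b j k)"
    if "j < N" for i j
  proof -
    have cancel: "(\<Prod>t<k. lin (b t)) * inverse D = inverse (\<Prod>t\<in>{k..<N}. lin (b t))"
      if "k \<le> j" for k
    proof -
      have "D = (\<Prod>t<k. lin (b t)) * (\<Prod>t\<in>{k..<N}. lin (b t))"
        using that \<open>j < N\<close> unfolding D_def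
        by (subst prod.union_disjoint[symmetric]) (auto intro!: prod.cong)
      then have "(\<Prod>t<k. lin (b t)) * inverse D
          = (\<Prod>t<k. lin (b t)) * inverse (\<Prod>t<k. lin (b t)) * inverse (\<Prod>t\<in>{k..<N}. lin (b t))"
        by (simp only: fps_inverse_mult mult_ac)
      then show ?thesis by simp
    qed
    have "(\<Prod>t<j. lin (c t)) * F i * inverse D = (\<Sum>k\<le>j. fps_const (newton_coeff c b j k) *
        (fps_X ^ (j - k) * (F i * ((\<Prod>t<k. lin (b t)) * inverse D))))"
      by (simp add: newton_interpolation[of c j b] sum_distrib_left sum_distrib_right mult_ac)
    also have "\<dots> = (\<Sum>k\<le>j. fps_const (newton_coeff c b j k) *
        (fps_X ^ (j - k) * (F i * inverse (\<Prod>t\<in>{k..<N}. lin (b t)))))"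
      by (rule sum.cong) (simp_all add: cancel)
    finally have "int_nth ((\<Prod>t<j. lin (c t)) * F i * inverse D) (m i + int j) =
        (\<Sum>k\<le>j. newton_coeff c b j k *
           int_nth (F i * inverse (\<Prod>t\<in>{k..<N}. lin (b t))) (m i + int j - int (j - k)))"
      by (simp only: int_nth_sum int_nth_const_mult int_nth_X_power_mult)
    also have "\<dots> = (\<Sum>k\<le>j. int_nth (F i * inverse (\<Prod>t\<in>{k..<N}. lin (b t))) (m i + int k)
        * newton_coeff c b j k)"
      by (rule sum.cong) auto
    also have "\<dots> = (\<Sum>k<N. int_nth (F i * inverse (\<Prod>t\<in>{k..<N}. lin (b t))) (m i + int k)
        * newton_coeff c b j k)"
      by (rule sum.mono_neutral_left) (use that in \<open>auto simp: newton_coeff_above\<close>)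
    finally show ?thesis .
  qed
  have "?M = ?A * T"
    by (rule eq_matI) (simp_all add: T_def scalar_prod_def entry[unfolded D_def] atLeast0LessThan)
  moreover have "det T = 1"
  proof -
    have "det T = prod_list (diag_mat T)"
      by (rule det_upper_triangular[of _ N]) (auto simp: T_def newton_coeff_above)
    also have "\<dots> = 1"
      unfolding prod_list_diag_prod by (rule prod.neutral) (simp add: T_def newton_coeff_diag)
    finally show ?thesis .
  qed
  ultimately show ?thesis
    by (simp add: det_mult[of _ N] T_def)
qed

text \<open>
  A permutation cannot map the \<open>r + 1\<close> indices \<open>i \<le> r\<close> into the \<open>r\<close> indices below \<open>r\<close>, so
  every term of the Leibniz expansion contains an entry of the zero block.
\<close>

lemma det_zero_block:
  assumes A: "A \<in> carrier_mat N N" and r: "r < N"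
    and zero: "\<And>i k. i \<le> r \<Longrightarrow> r \<le> k \<Longrightarrow> k < N \<Longrightarrow> A $$ (i, k) = 0"
  shows "det A = (0 :: 'a :: comm_ring_1)"
  unfolding det_def'[OF A]
proof (rule sum.neutral, safe)
  fix p assume p: "p permutes {0..<N}"
  have "\<exists>i\<le>r. r \<le> p i"
  proof (rule ccontr)
    assume "\<not> ?thesis"
    then have "p ` {..r} \<subseteq> {..<r}" by auto
    then have "card (p ` {..r}) \<le> card {..<r}" by (intro card_mono) auto
    moreover have "card (p ` {..r}) = card {..r}"
      using permutes_inj[OF p] by (intro card_image) (rule inj_on_subset, auto)
    ultimately show False by simp
  qed
  then obtain i where i: "i \<le> r" "r \<le> p i" by blast
  moreover have "p i < N" using permutes_in_image[OF p, of i] i r by simp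
  ultimately have "A $$ (i, p i) = 0" by (rule zero)
  then have "(\<Prod>i = 0..<N. A $$ (i, p i)) = 0"
    using i r by (intro prod_zero) auto
  then show "signof p * (\<Prod>i = 0..<N. A $$ (i, p i)) = 0" by simp
qed

section \<open>Entries of the determinant in the new basis\<close>

lemma maya_ge: "t < N \<Longrightarrow> 1 - int N \<le> maya \<nu> t"
  by (simp add: maya_def)

text \<open>
  All zeros of the denominator are among those of the numerator, and the quotient has fewer than
  \<open>m + k\<close> factors.
\<close>

lemma newton_entry_eq_0:
  assumes \<nu>: "young_diagram \<nu>" and k: "k < N" and m: "maya \<nu> k < m"
  shows "int_nth ((\<Prod>r\<in>{1 - int N..m - 1}. lin (a r)) *
      inverse (\<Prod>t\<in>{k..<N}. lin (a (maya \<nu> t)))) (m + int k) = 0"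
proof -
  let ?S = "{1 - int N..m - 1} - maya \<nu> ` {k..<N}"
  have sub: "maya \<nu> ` {k..<N} \<subseteq> {1 - int N..m - 1}"
  proof safe
    fix t assume "t \<in> {k..<N}"
    moreover from this have "maya \<nu> t \<le> maya \<nu> k"
      using maya_strict_antimono[OF \<nu>, of k t] by (cases "t = k") auto
    ultimately show "maya \<nu> t \<in> {1 - int N..m - 1}" using m maya_ge[of t N \<nu>] by simp
  qed
  have "card ?S = nat (m + int k - 1)"
    using sub k by (simp add: card_Diff_subset card_image[OF inj_on_maya[OF \<nu>]] nat_diff_distrib')
  moreover have "m + int k > 0" using m k maya_ge[of k "Suc k" \<nu>] by simp
  ultimately have "fps_nth (\<Prod>r\<in>?S. lin (a r)) (nat (m + int k)) = 0"
    by (intro prod_lin_nth_eq_0) auto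
  then show ?thesis
    using sub by (simp add: prod_lin_quotient inj_on_maya[OF \<nu>] int_nth_def)
qed

text \<open>
  All factors of the denominator cancel except \<open>lin (a m)\<close> itself, and the factors that survive in the
  numerator are indexed by the gaps below \<open>m\<close>. There are exactly \<open>m + k\<close> of them, so the coefficient is
  the value of a polynomial at \<open>a m\<close>.
\<close>

lemma newton_entry_diag:
  assumes \<nu>: "young_diagram \<nu>" and N: "num_rows \<nu> \<le> N" and k: "k < N" and m: "m = maya \<nu> k"
  shows "int_nth ((\<Prod>r\<in>{1 - int N..m - 1}. lin (a r)) *
      inverse (\<Prod>t\<in>{k..<N}. lin (a (maya \<nu> t)))) (m + int k)
    = (\<Prod>j\<in>{1..row_len \<nu> (k + 1)}. a m - a (gap \<nu> j))"
proof -
  let ?R = "{1 - int N..m - 1}" and ?c = "row_len \<nu> (k + 1)"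
  note union = gap_Un_maya[OF \<nu> N, of "k + 1" ?c]
  have col: "k + 1 \<le> col_len \<nu> j" if "1 \<le> j" "j \<le> ?c" for j
    using row_len_col_len[OF \<nu>, of "k + 1" j] that by simp
  have row: "row_len \<nu> (k + 1 + 1) \<le> ?c"
    by (rule row_len_antimono[OF \<nu>]) auto
  have R: "?R = {1 - int N..int ?c - int (k + 1)}" by (simp add: m maya_def)
  have "gap \<nu> ` {1..?c} \<union> maya \<nu> ` {k + 1..<N} = ?R"
    and "gap \<nu> ` {1..?c} \<inter> maya \<nu> ` {k + 1..<N} = {}"
    unfolding R using k by (intro union col row; simp)+
  then have S: "?R - maya \<nu> ` {k + 1..<N} = gap \<nu> ` {1..?c}" and sub: "maya \<nu> ` {k + 1..<N} \<subseteq> ?R"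
    by blast+
  have "{k..<N} = insert k {k + 1..<N}" using k by auto
  then have "inverse (\<Prod>t\<in>{k..<N}. lin (a (maya \<nu> t)))
      = inverse (\<Prod>t\<in>{k + 1..<N}. lin (a (maya \<nu> t))) * inverse (lin (a m))"
    by (simp add: fps_inverse_mult m)
  then have "(\<Prod>r\<in>?R. lin (a r)) * inverse (\<Prod>t\<in>{k..<N}. lin (a (maya \<nu> t)))
      = (\<Prod>r\<in>?R. lin (a r)) * inverse (\<Prod>t\<in>{k + 1..<N}. lin (a (maya \<nu> t))) * inverse (lin (a m))"
    by (simp only: mult.assoc)
  also have "\<dots> = (\<Prod>r\<in>gap \<nu> ` {1..?c}. lin (a r)) * inverse (lin (a m))"
    using sub by (simp only: prod_lin_quotient inj_on_maya[OF \<nu>] S finite_atLeastAtMost_int)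
  finally have eq: "(\<Prod>r\<in>?R. lin (a r)) * inverse (\<Prod>t\<in>{k..<N}. lin (a (maya \<nu> t)))
      = (\<Prod>r\<in>gap \<nu> ` {1..?c}. lin (a r)) * inverse (lin (a m))" .
  have card: "card (gap \<nu> ` {1..?c}) = ?c"
    by (simp only: card_image[OF inj_on_gap[OF \<nu>]] card_atLeastAtMost diff_Suc_1')
  have "m + int k = int ?c" by (simp add: m maya_def)
  then have "int_nth ((\<Prod>r\<in>?R. lin (a r)) * inverse (\<Prod>t\<in>{k..<N}. lin (a (maya \<nu> t)))) (m + int k)
      = fps_nth ((\<Prod>r\<in>gap \<nu> ` {1..?c}. lin (a r)) * inverse (lin (a m))) (card (gap \<nu> ` {1..?c}))"
    by (simp only: int_nth_def eq card) simp
  also have "\<dots> = (\<Prod>r\<in>gap \<nu> ` {1..?c}. a m - a r)"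
    by (rule prod_lin_divide_lin_nth_card) simp
  also have "\<dots> = (\<Prod>j\<in>{1..?c}. a m - a (gap \<nu> j))"
    by (simp only: prod.reindex[OF inj_on_gap[OF \<nu>]] o_def)
  finally show ?thesis .
qed

section \<open>Substitutions as ring homomorphisms\<close>

definition mono_eval :: "(nat \<Rightarrow> complex) \<Rightarrow> (nat \<Rightarrow>\<^sub>0 nat) \<Rightarrow> complex" where
  "mono_eval \<phi> m = (\<Prod>i\<in>Poly_Mapping.keys m. \<phi> (i + 1) ^ Poly_Mapping.lookup m i)"

lemma mono_eval_superset:
  assumes "finite S" "Poly_Mapping.keys m \<subseteq> S"
  shows "mono_eval \<phi> m = (\<Prod>i\<in>S. \<phi> (i + 1) ^ Poly_Mapping.lookup m i)"
  unfolding mono_eval_def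
  by (rule prod.mono_neutral_left) (use assms in \<open>auto simp: in_keys_iff\<close>)

lemma mono_eval_add: "mono_eval \<phi> (m + n) = mono_eval \<phi> m * mono_eval \<phi> n"
proof -
  let ?S = "Poly_Mapping.keys m \<union> Poly_Mapping.keys n"
  have "mono_eval \<phi> (m + n) = (\<Prod>i\<in>?S. \<phi> (i + 1) ^ Poly_Mapping.lookup (m + n) i)"
    by (rule mono_eval_superset) (simp_all add: Poly_Mapping.keys_add)
  also have "\<dots> = (\<Prod>i\<in>?S. \<phi> (i + 1) ^ Poly_Mapping.lookup m i)
      * (\<Prod>i\<in>?S. \<phi> (i + 1) ^ Poly_Mapping.lookup n i)"
    by (simp add: lookup_add power_add prod.distrib)
  also have "\<dots> = mono_eval \<phi> m * mono_eval \<phi> n"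
    by (subst (1 2) mono_eval_superset[of ?S]) auto
  finally show ?thesis .
qed

lemma sym_subst_superset:
  assumes "finite S" "Poly_Mapping.keys f \<subseteq> S"
  shows "sym_subst \<phi> f = (\<Sum>m\<in>S. Poly_Mapping.lookup f m * mono_eval \<phi> m)"
  unfolding sym_subst_def mono_eval_def[symmetric]
  by (rule sum.mono_neutral_left) (use assms in \<open>auto simp: in_keys_iff\<close>)

lemma sym_subst_single: "sym_subst \<phi> (Poly_Mapping.single m c) = c * mono_eval \<phi> m"
  by (subst sym_subst_superset[of "{m}"]) auto

lemma sym_subst_add: "sym_subst \<phi> (f + g) = sym_subst \<phi> f + sym_subst \<phi> g"
proof -
  let ?S = "Poly_Mapping.keys f \<union> Poly_Mapping.keys g"
  have "sym_subst \<phi> (f + g) = (\<Sum>m\<in>?S. Poly_Mapping.lookup (f + g) m * mono_eval \<phi> m)"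
    by (rule sym_subst_superset) (simp_all add: Poly_Mapping.keys_add)
  also have "\<dots> = (\<Sum>m\<in>?S. Poly_Mapping.lookup f m * mono_eval \<phi> m)
      + (\<Sum>m\<in>?S. Poly_Mapping.lookup g m * mono_eval \<phi> m)"
    by (simp add: lookup_add distrib_right sum.distrib)
  also have "\<dots> = sym_subst \<phi> f + sym_subst \<phi> g"
    by (subst (1 2) sym_subst_superset[of ?S]) auto
  finally show ?thesis .
qed

lemma sym_subst_0 [simp]: "sym_subst \<phi> 0 = 0"
  by (simp add: sym_subst_def)

lemma sym_subst_sum: "sym_subst \<phi> (\<Sum>i\<in>I. f i) = (\<Sum>i\<in>I. sym_subst \<phi> (f i))"
  by (induction I rule: infinite_finite_induct) (simp_all add: sym_subst_add)

lemma sum_monomials: "f = (\<Sum>m\<in>Poly_Mapping.keys f. Poly_Mapping.single m (Poly_Mapping.lookup f m))"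
  for f :: "'a \<Rightarrow>\<^sub>0 'b :: comm_monoid_add"
proof (rule poly_mapping_eqI)
  fix n
  show "Poly_Mapping.lookup f n = Poly_Mapping.lookup
    (\<Sum>m\<in>Poly_Mapping.keys f. Poly_Mapping.single m (Poly_Mapping.lookup f m)) n"
    by (auto simp: lookup_sum lookup_single when_def in_keys_iff)
qed

text \<open>
  On monomials this is \<open>mono_eval_add\<close>; the general case follows by bilinearity.
\<close>

lemma sym_subst_mult: "sym_subst \<phi> (f * g) = sym_subst \<phi> f * sym_subst \<phi> g"
proof -
  let ?l = Poly_Mapping.lookup
  have "f * g = (\<Sum>m\<in>Poly_Mapping.keys f. \<Sum>n\<in>Poly_Mapping.keys g.
      Poly_Mapping.single (m + n) (?l f m * ?l g n))"
    by (subst sum_monomials[of f], subst sum_monomials[of g])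
       (simp add: sum_product mult_single)
  then have "sym_subst \<phi> (f * g) = (\<Sum>m\<in>Poly_Mapping.keys f. \<Sum>n\<in>Poly_Mapping.keys g.
      (?l f m * mono_eval \<phi> m) * (?l g n * mono_eval \<phi> n))"
    by (simp add: sym_subst_sum sym_subst_single mono_eval_add mult_ac)
  also have "\<dots> = sym_subst \<phi> f * sym_subst \<phi> g"
    unfolding sum_product[symmetric]
    by (subst (1 2) sym_subst_superset[OF finite_keys subset_refl]) simp
  finally show ?thesis .
qed

lemma mono_eval_0 [simp]: "mono_eval \<phi> 0 = 1"
  by (simp add: mono_eval_def)

lemma sym_subst_const [simp]: "sym_subst \<phi> (sym_const c) = c"
  by (simp add: sym_const_def sym_subst_single)

lemma sym_const_0 [simp]: "sym_const 0 = 0"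
  by (simp add: sym_const_def)

lemma sym_const_1 [simp]: "sym_const 1 = 1"
  by (simp add: sym_const_def)

lemma sym_const_add: "sym_const (c + d) = sym_const c + sym_const d"
  by (simp add: sym_const_def single_add)

lemma sym_const_mult: "sym_const (c * d) = sym_const c * sym_const d"
  by (simp add: sym_const_def mult_single)

lemma sym_const_sum: "sym_const (\<Sum>i\<in>I. c i) = (\<Sum>i\<in>I. sym_const (c i))"
  by (induction I rule: infinite_finite_induct) (simp_all add: sym_const_add)

lemma sym_subst_power_sum: "1 \<le> k \<Longrightarrow> sym_subst \<phi> (power_sum k) = \<phi> k"
  by (simp add: power_sum_def sym_subst_single mono_eval_def)

interpretation sym_subst: comm_ring_hom "sym_subst \<phi>"
  by unfold_locales (simp_all add: sym_subst_add sym_subst_mult flip: sym_const_1)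

section \<open>A closed formula for the multiparameter complete functions\<close>

lemma fps_lift_mult: "fps_lift (F * G) = fps_lift F * fps_lift G"
  by (rule fps_ext) (simp add: fps_lift_def fps_mult_nth sym_const_sum sym_const_mult)

lemma inv_u_minus_eq: "inv_u_minus c = fps_X * inverse (lin c)"
  by (simp add: inv_u_minus_def lin_def fps_divide_unit)

text \<open>
  Multiplication by \<open>lin (b 1) \<dots> lin (b (k - 1))\<close> makes the coefficient of \<open>X\<^sup>k\<close> dual to the functions
  \<open>1 / ((u - b\<^sub>1) \<dots> (u - b\<^sub>l))\<close>: for \<open>l < k\<close> the product is a polynomial in \<open>X\<close> of degree less than \<open>k\<close>.
\<close>

lemma prod_inv_u_minus_mult_prod_lin_nth:
  assumes "l \<le> k"
  shows "fps_nth ((\<Prod>i=1..l. inv_u_minus (b i)) * (\<Prod>i=1..k - 1. lin (b i))) k = (if l = k then 1 else 0)"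
proof -
  have inv: "inverse (\<Prod>i\<in>I. lin (b i)) = (\<Prod>i\<in>I. inverse (lin (b i)))" for I :: "nat set"
    by (induction I rule: infinite_finite_induct) (auto simp: fps_inverse_mult)
  have E: "(\<Prod>i=1..l. inv_u_minus (b i)) = fps_X ^ l * inverse (\<Prod>i=1..l. lin (b i))"
    by (simp add: inv_u_minus_eq prod.distrib inv)
  show ?thesis
  proof (cases "l = k")
    case True
    have "(\<Prod>i=1..l. inv_u_minus (b i)) * (\<Prod>i=1..k - 1. lin (b i))
        = fps_X ^ l * (inverse (\<Prod>i=1..l. lin (b i)) * (\<Prod>i=1..k - 1. lin (b i)))"
      by (simp only: E mult.assoc)
    then show ?thesis unfolding True by (simp only: fps_X_power_mult_nth) simp
  next
    case False
    then have "(\<Prod>i=1..k - 1. lin (b i)) * inverse (\<Prod>i\<in>{1..l}. lin (b (id i)))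
        = (\<Prod>i\<in>{1..k - 1} - id ` {1..l}. lin (b i))"
      using assms by (intro prod_lin_quotient) auto
    then have eq: "(\<Prod>i=1..l. inv_u_minus (b i)) * (\<Prod>i=1..k - 1. lin (b i))
        = fps_X ^ l * (\<Prod>i\<in>{1..k - 1} - {1..l}. lin (b i))"
      by (simp only: E mult_ac id_apply image_id)
    have "card ({1..k - 1} - {1..l}) < k - l"
      using assms False by (subst card_Diff_subset) auto
    then show ?thesis
      using False assms unfolding eq by (simp add: fps_X_power_mult_nth prod_lin_nth_eq_0)
  qed
qed

text \<open>
  Extract the coefficient of \<open>1 / ((u - a\<^sub>1) \<dots> (u - a\<^sub>k))\<close> from the expansion of \<open>H(u)\<close> by the duality
  above. Terms with \<open>l > k\<close> do not affect the coefficient of \<open>X\<^sup>k\<close>. Both the degree bound and the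
  values of \<open>h\<^bsub>k;a\<^esub>\<close> are read off from this formula.
\<close>

lemma multi_h_eq_nth:
  "multi_h a (int k) = fps_nth (H_series * fps_lift (\<Prod>i=1..k - 1. lin (a (int i)))) k"
proof -
  define h where "h = (THE h. is_multi_h a h)"
  define E where "E l = (\<Prod>i=1..l. inv_u_minus (a (int i)))" for l
  define D where "D = (\<Prod>i=1..k - 1. lin (a (int i)))"
  have "is_multi_h a h" unfolding h_def by (rule theI'[OF ex1_multi_h])
  then have "(\<lambda>l. fps_const (h l) * fps_lift (E l)) sums H_series"
    by (simp add: is_multi_h_def E_def)
  moreover have E0: "fps_nth (fps_lift (E l)) n = 0" if "n < l" for l n
    using that fps_nth_prod_inv_u_minus[of n l "\<lambda>i. a (int i)"] by (simp add: E_def fps_lift_def)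
  ultimately have H: "fps_nth H_series n = (\<Sum>l\<le>n. h l * fps_nth (fps_lift (E l)) n)" for n
    by (subst (asm) fps_sums_iff) auto
  have H': "fps_nth H_series n = (\<Sum>l\<le>k. h l * fps_nth (fps_lift (E l)) n)" if "n \<le> k" for n
    unfolding H by (rule sum.mono_neutral_left) (use that E0 in auto)
  have "fps_nth (H_series * fps_lift D) k
      = (\<Sum>n=0..k. \<Sum>l\<le>k. h l * (fps_nth (fps_lift (E l)) n * fps_nth (fps_lift D) (k - n)))"
    unfolding fps_mult_nth by (rule sum.cong) (simp_all add: H' sum_distrib_right mult.assoc)
  also have "\<dots> = (\<Sum>l\<le>k. h l * fps_nth (fps_lift (E l) * fps_lift D) k)"
    by (subst sum.swap) (simp add: fps_mult_nth sum_distrib_left)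
  also have "\<dots> = (\<Sum>l\<le>k. if l = k then h l else 0)"
  proof (rule sum.cong)
    fix l assume "l \<in> {..k}"
    then have "fps_nth (E l * D) k = (if l = k then 1 else 0)"
      unfolding E_def D_def by (intro prod_inv_u_minus_mult_prod_lin_nth) simp
    then show "h l * fps_nth (fps_lift (E l) * fps_lift D) k = (if l = k then h l else 0)"
      unfolding fps_lift_mult[symmetric] by (simp add: fps_lift_def)
  qed simp
  finally show ?thesis by (simp add: multi_h_def h_def D_def)
qed

section \<open>The generating series at a Young diagram\<close>

definition subst_fps :: "(nat \<Rightarrow> complex) \<Rightarrow> sym_fun fps \<Rightarrow> complex fps" where
  "subst_fps \<phi> F = Abs_fps (\<lambda>n. sym_subst \<phi> (fps_nth F n))"

lemma subst_fps_nth [simp]: "fps_nth (subst_fps \<phi> F) n = sym_subst \<phi> (fps_nth F n)"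
  by (simp add: subst_fps_def)

lemma subst_fps_mult: "subst_fps \<phi> (F * G) = subst_fps \<phi> F * subst_fps \<phi> G"
  by (rule fps_ext) (simp add: fps_mult_nth sym_subst_sum sym_subst_mult)

lemma subst_fps_1: "subst_fps \<phi> 1 = 1"
  by (rule fps_ext) simp

lemma subst_fps_power: "subst_fps \<phi> (F ^ n) = subst_fps \<phi> F ^ n"
  by (induction n) (simp_all add: subst_fps_1 subst_fps_mult)

lemma subst_fps_compose: "subst_fps \<phi> (F oo G) = subst_fps \<phi> F oo subst_fps \<phi> G"
  by (rule fps_ext)
     (simp add: fps_compose_nth sym_subst_sum sym_subst_mult flip: subst_fps_power)

lemma subst_fps_lift: "subst_fps \<phi> (fps_lift F) = F"
  by (rule fps_ext) (simp add: fps_lift_def)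

lemma sym_subst_multi_h:
  "sym_subst \<phi> (multi_h a (int k)) = fps_nth (subst_fps \<phi> H_series * (\<Prod>i=1..k - 1. lin (a (int i)))) k"
  by (simp add: multi_h_eq_nth subst_fps_mult subst_fps_lift flip: subst_fps_nth)

lemma subst_fps_H_series:
  "subst_fps \<phi> H_series = fps_exp 1 oo Abs_fps (\<lambda>k. if k = 0 then 0 else \<phi> k / of_nat k)"
proof -
  have "subst_fps \<phi> (Abs_fps (\<lambda>k. if k = 0 then 0 else sym_const (1 / of_nat k) * power_sum k))
      = Abs_fps (\<lambda>k. if k = 0 then 0 else \<phi> k / of_nat k)"
    by (rule fps_ext) (simp add: sym_subst_mult sym_subst_power_sum)
  then show ?thesis
    by (simp add: H_series_def subst_fps_compose subst_fps_lift)
qed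

text \<open>
  A series with a prescribed logarithmic derivative \<open>L\<close> is determined by its constant term. This
  identifies an exponential with a product without a formal logarithm.
\<close>

lemma fps_log_deriv_unique:
  fixes F G :: "'a :: field_char_0 fps"
  assumes "fps_deriv F = F * L" "fps_deriv G = G * L" "fps_nth F 0 = fps_nth G 0"
  shows "F = G"
proof (rule fps_ext)
  fix n show "fps_nth F n = fps_nth G n"
  proof (induction n rule: less_induct)
    case (less n)
    show ?case
    proof (cases n)
      case 0 then show ?thesis using assms(3) by simp
    next
      case (Suc k)
      have "of_nat (Suc k) * fps_nth F (Suc k) = fps_nth (F * L) k"
        by (simp flip: assms(1))
      also have "\<dots> = fps_nth (G * L) k"
        unfolding fps_mult_nth by (rule sum.cong) (use less Suc in auto)
      also have "\<dots> = of_nat (Suc k) * fps_nth G (Suc k)"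
        by (simp flip: assms(2))
      finally show ?thesis using Suc by (simp del: of_nat_Suc)
    qed
  qed
qed

text \<open>
  The expansion of \<open>c / (1 - c X)\<close>, the logarithmic derivative of \<open>1 / lin c\<close>.
\<close>

definition geometric :: "complex \<Rightarrow> complex fps" where
  "geometric c = Abs_fps (\<lambda>k. c ^ (k + 1))"

lemma fps_deriv_prod_lin:
  "fps_deriv (\<Prod>i\<in>I. lin (c i)) = (\<Prod>i\<in>I. lin (c i)) * - (\<Sum>i\<in>I. geometric (c i))"
proof -
  have lin: "fps_deriv (lin d) = lin d * - geometric d" for d
  proof (rule fps_ext)
    fix n show "fps_nth (fps_deriv (lin d)) n = fps_nth (lin d * - geometric d) n"
      by (cases n) (simp_all add: lin_mult_nth_Suc geometric_def, simp_all add: lin_def)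
  qed
  show ?thesis
    by (induction I rule: infinite_finite_induct) (simp_all add: lin algebra_simps)
qed

lemma fps_deriv_inverse_log:
  assumes "fps_deriv F = F * L" "fps_nth F 0 \<noteq> 0"
  shows "fps_deriv (inverse F) = inverse F * - (L :: complex fps)"
proof -
  have "fps_deriv (inverse F) = - (F * inverse F) * L * inverse F"
    using assms by (simp add: fps_inverse_deriv power2_eq_square mult_ac)
  then show ?thesis
    using assms(2) by (simp add: inverse_mult_eq_1' mult_ac)
qed

text \<open>
  The value of the power sum \<open>p\<^sub>k\<close> at \<open>(x(\<nu>); y(\<nu>))\<close>, for \<open>k \<ge> 1\<close>.
\<close>

definition frob_power_sum :: "(int \<Rightarrow> complex) \<Rightarrow> (nat \<times> nat) set \<Rightarrow> nat \<Rightarrow> complex" where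
  "frob_power_sum a \<nu> k =
     Sum_any (\<lambda>i. frob_x a \<nu> i ^ k) + (-1) ^ (k - 1) * Sum_any (\<lambda>i. frob_y a \<nu> i ^ k)"

lemma diagram_eval_eq: "diagram_eval a \<nu> = sym_subst (frob_power_sum a \<nu>)"
  unfolding diagram_eval_def super_eval_def frob_power_sum_def by (rule refl)

lemma Sum_any_power:
  fixes x :: "nat \<Rightarrow> complex"
  assumes "1 \<le> k" and x: "\<And>i. i \<notin> {1..d} \<Longrightarrow> x i = 0"
  shows "Sum_any (\<lambda>i. x i ^ k) = (\<Sum>i\<in>{1..d}. x i ^ k)"
proof (rule Sum_any.expand_superset)
  show "{i. x i ^ k \<noteq> 0} \<subseteq> {1..d}"
  proof (rule subsetI, rule ccontr)
    fix i assume "i \<in> {i. x i ^ k \<noteq> 0}" "i \<notin> {1..d}"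
    then show False using x[of i] assms(1) by (simp add: power_0_left)
  qed
qed simp

lemma frob_power_sum_Suc:
  "frob_power_sum a \<nu> (k + 1) =
     (\<Sum>t<diag_len \<nu>. a (maya \<nu> t) ^ (k + 1)) - (\<Sum>j\<in>{1..diag_len \<nu>}. a (gap \<nu> j) ^ (k + 1))"
proof -
  let ?d = "diag_len \<nu>"
  have "Sum_any (\<lambda>i. frob_x a \<nu> i ^ (k + 1)) = (\<Sum>i\<in>{1..?d}. frob_x a \<nu> i ^ (k + 1))"
    by (rule Sum_any_power) (auto simp: frob_x_def)
  also have "\<dots> = (\<Sum>t<?d. a (maya \<nu> t) ^ (k + 1))"
    by (rule sum.reindex_bij_witness[of _ Suc "\<lambda>i. i - 1"])
       (auto simp: frob_x_def maya_def algebra_simps)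
  finally have x: "Sum_any (\<lambda>i. frob_x a \<nu> i ^ (k + 1)) = (\<Sum>t<?d. a (maya \<nu> t) ^ (k + 1))" .
  have y1: "frob_y a \<nu> j = - a (gap \<nu> j)" if "j \<in> {1..?d}" for j
    using that by (simp add: frob_y_def dual_params_def gap_def)
  have "Sum_any (\<lambda>i. frob_y a \<nu> i ^ (k + 1)) = (\<Sum>i\<in>{1..?d}. frob_y a \<nu> i ^ (k + 1))"
    by (rule Sum_any_power) (auto simp: frob_y_def)
  also have "\<dots> = (\<Sum>j\<in>{1..?d}. (- a (gap \<nu> j)) ^ (k + 1))"
    by (rule sum.cong) (simp_all add: y1)
  finally have "(-1) ^ k * Sum_any (\<lambda>i. frob_y a \<nu> i ^ (k + 1))
      = (\<Sum>j\<in>{1..?d}. (-1) ^ k * (- a (gap \<nu> j)) ^ (k + 1))"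
    by (simp only: sum_distrib_left)
  also have "\<dots> = (\<Sum>j\<in>{1..?d}. - (a (gap \<nu> j) ^ (k + 1)))"
    by (rule sum.cong) (simp_all add: uminus_power_if)
  finally show ?thesis
    unfolding frob_power_sum_def x by (simp add: sum_negf)
qed

text \<open>
  Both sides have constant term 1 and the logarithmic derivative with coefficients \<open>p\<^sub>1, p\<^sub>2, \<dots>\<close>. The
  numerator is \<open>\<Prod>i. (1 + y\<^sub>i X)\<close>, since \<open>y\<^sub>i = - a (gap \<nu> i)\<close>.
\<close>

lemma H_series_eval_frobenius:
  "subst_fps (frob_power_sum a \<nu>) H_series =
     (\<Prod>j\<in>{1..diag_len \<nu>}. lin (a (gap \<nu> j))) * inverse (\<Prod>t<diag_len \<nu>. lin (a (maya \<nu> t)))"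
    (is "?E = ?num * inverse ?den")
proof (rule fps_log_deriv_unique)
  define L where "L = Abs_fps (\<lambda>k. frob_power_sum a \<nu> (k + 1))"
  define l where "l = Abs_fps (\<lambda>k. if k = 0 then 0 else frob_power_sum a \<nu> k / of_nat k)"
  have "fps_deriv l = L"
    by (rule fps_ext) (simp add: l_def L_def del: of_nat_Suc)
  moreover have "fps_deriv ?E = (fps_deriv (fps_exp 1) oo l) * fps_deriv l"
    unfolding subst_fps_H_series l_def[symmetric] by (rule fps_compose_deriv) (simp add: l_def)
  ultimately show "fps_deriv ?E = ?E * L"
    by (simp add: subst_fps_H_series l_def)
  have L: "L = (\<Sum>t<diag_len \<nu>. geometric (a (maya \<nu> t))) - (\<Sum>j\<in>{1..diag_len \<nu>}. geometric (a (gap \<nu> j)))"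
    by (rule fps_ext) (simp only: L_def fps_nth_Abs_fps frob_power_sum_Suc fps_sub_nth fps_sum_nth geometric_def)
  have "fps_deriv (inverse ?den) = inverse ?den * - (- (\<Sum>t<diag_len \<nu>. geometric (a (maya \<nu> t))))"
    by (rule fps_deriv_inverse_log[OF fps_deriv_prod_lin]) simp
  then show "fps_deriv (?num * inverse ?den) = (?num * inverse ?den) * L"
    by (simp add: fps_deriv_prod_lin L algebra_simps)
  show "fps_nth ?E 0 = fps_nth (?num * inverse ?den) 0"
    by (simp add: subst_fps_H_series)
qed

lemma prod_lin_interval: "(\<Prod>t<N. lin (a (- int t))) = (\<Prod>r\<in>{1 - int N..0}. lin (a r))"
  by (rule prod.reindex_bij_witness[of _ "\<lambda>r. nat (- r)" "\<lambda>t. - int t"]) auto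

text \<open>
  Extend the Frobenius form by the factors of the rows below the diagonal. In the numerator they
  complete the gaps \<open>- Q\<^sub>i\<close> to the full interval of the indices \<open>- t\<close>, by \<open>gap_Un_maya\<close> at the boundary
  point on the diagonal.
\<close>

lemma H_series_eval_diagram:
  assumes \<nu>: "young_diagram \<nu>" and N: "num_rows \<nu> \<le> N"
  shows "subst_fps (frob_power_sum a \<nu>) H_series =
    (\<Prod>t<N. lin (a (- int t))) * inverse (\<Prod>t<N. lin (a (maya \<nu> t)))"
proof -
  let ?d = "diag_len \<nu>"
  have d: "?d \<le> N" using diag_len_le_num_rows[OF \<nu>] N by simp
  have col: "?d \<le> col_len \<nu> j" if "1 \<le> j" "j \<le> ?d" for j
    using that diag_len_iff_col[OF \<nu>, of ?d] col_len_antimono[OF \<nu>, of j ?d] by simp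
  have row: "row_len \<nu> (?d + 1) \<le> ?d"
    using diag_len_iff_row[OF \<nu>, of "?d + 1"] by simp
  have un: "gap \<nu> ` {1..?d} \<union> maya \<nu> ` {?d..<N} = {1 - int N..0}"
    and disj: "gap \<nu> ` {1..?d} \<inter> maya \<nu> ` {?d..<N} = {}"
    using gap_Un_maya[OF \<nu> N d col row] by simp_all
  have "(\<Prod>t<N. lin (a (- int t)))
      = (\<Prod>r\<in>gap \<nu> ` {1..?d}. lin (a r)) * (\<Prod>r\<in>maya \<nu> ` {?d..<N}. lin (a r))"
    unfolding prod_lin_interval un[symmetric] by (rule prod.union_disjoint) (use disj in auto)
  also have "\<dots> = (\<Prod>j\<in>{1..?d}. lin (a (gap \<nu> j))) * (\<Prod>t\<in>{?d..<N}. lin (a (maya \<nu> t)))"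
    by (simp only: prod.reindex inj_on_gap[OF \<nu>] inj_on_maya[OF \<nu>] o_def)
  finally have num: "(\<Prod>t<N. lin (a (- int t)))
      = (\<Prod>j\<in>{1..?d}. lin (a (gap \<nu> j))) * (\<Prod>t\<in>{?d..<N}. lin (a (maya \<nu> t)))" .
  have "{..<N} = {..<?d} \<union> {?d..<N}" using d by auto
  then have "(\<Prod>t<N. lin (a (maya \<nu> t))) = (\<Prod>t<?d. lin (a (maya \<nu> t))) * (\<Prod>t\<in>{?d..<N}. lin (a (maya \<nu> t)))"
    by (simp add: prod.union_disjoint ivl_disj_int)
  then have "(\<Prod>t<N. lin (a (- int t))) * inverse (\<Prod>t<N. lin (a (maya \<nu> t)))
      = (\<Prod>j\<in>{1..?d}. lin (a (gap \<nu> j))) * inverse (\<Prod>t<?d. lin (a (maya \<nu> t)))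
        * ((\<Prod>t\<in>{?d..<N}. lin (a (maya \<nu> t))) * inverse (\<Prod>t\<in>{?d..<N}. lin (a (maya \<nu> t))))"
    by (simp only: num fps_inverse_mult mult_ac)
  then show ?thesis
    by (simp only: prod_lin_mult_inverse H_series_eval_frobenius mult_1_right)
qed

text \<open>
  With \<open>k = m + j\<close>, the closed formula contributes the factors with indices from \<open>1 - j\<close> to \<open>m - 1\<close>, and
  \<open>H\<close> those from \<open>1 - N\<close> to \<open>0\<close>. Exchanging the two ranges at the cut \<open>- j\<close> separates a factor that
  depends only on the column \<open>j\<close> from one that depends only on \<open>m\<close>, hence on the row. For
  \<open>k \<le> 0\<close> both sides are 0 or 1.
\<close>

lemma multi_h_eval:
  assumes \<nu>: "young_diagram \<nu>" and N: "num_rows \<nu> \<le> N" and j: "j < N"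
  shows "diagram_eval a \<nu> (multi_h (shift (- int j) a) (m + int j)) =
    int_nth ((\<Prod>t<j. lin (a (- int t))) * (\<Prod>r\<in>{1 - int N..m - 1}. lin (a r))
      * inverse (\<Prod>t<N. lin (a (maya \<nu> t)))) (m + int j)"
proof -
  define Q where "Q = inverse (\<Prod>t<N. lin (a (maya \<nu> t)))"
  have Q0: "fps_nth Q 0 = 1" by (simp add: Q_def)
  consider "m + int j < 0" | "m + int j = 0" | k where "m + int j = int k" "1 \<le> k"
    using zero_less_imp_eq_int[of "m + int j"]
    by (cases "m + int j" "0 :: int" rule: linorder_cases) (auto simp: Suc_le_eq)
  then show ?thesis
  proof cases
    case 1
    then show ?thesis by (simp add: diagram_eval_eq multi_h_def int_nth_def)
  next
    case 2
    then show ?thesis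
      using sym_subst_multi_h[of "frob_power_sum a \<nu>" "shift (- int j) a" 0]
      by (simp add: diagram_eval_eq int_nth_def subst_fps_H_series)
  next
    case (3 k)
    have shifted: "(\<Prod>i=1..k - 1. lin (shift (- int j) a (int i))) = (\<Prod>r\<in>{1 - int j..m - 1}. lin (a r))"
      using 3 by (intro prod.reindex_bij_witness[of _ "\<lambda>r. nat (r + int j)" "\<lambda>i. int i - int j"])
        (auto simp: shift_def)
    have split: "(\<Prod>r\<in>{1 - int N..s}. lin (a r)) =
        (\<Prod>r\<in>{1 - int N..- int j}. lin (a r)) * (\<Prod>r\<in>{1 - int j..s}. lin (a r))"
      if "s \<ge> - int j" for s
    proof -
      have "{1 - int N..s} = {1 - int N..- int j} \<union> {1 - int j..s}" using that j by auto
      then show ?thesis by (simp add: prod.union_disjoint)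
    qed
    have eq: "(\<Prod>t<N. lin (a (- int t))) * Q * (\<Prod>i=1..k - 1. lin (shift (- int j) a (int i)))
        = (\<Prod>t<j. lin (a (- int t))) * (\<Prod>r\<in>{1 - int N..m - 1}. lin (a r)) * Q"
      unfolding shifted prod_lin_interval using split[of 0] split[of "m - 1"] 3 by (simp add: mult_ac)
    show ?thesis
      using sym_subst_multi_h[of "frob_power_sum a \<nu>" "shift (- int j) a" k]
      unfolding diagram_eval_eq H_series_eval_diagram[OF \<nu> N] Q_def[symmetric] eq 3(1)
      by (simp add: int_nth_def)
  qed
qed

section \<open>Values of multiparameter Schur functions\<close>

lemma multi_h_0 [simp]: "multi_h a 0 = 1"
  using multi_h_eq_nth[of a 0] by (simp add: H_series_def fps_lift_def)

lemma multi_h_neg [simp]: "k < 0 \<Longrightarrow> multi_h a k = 0"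
  by (simp add: multi_h_def)

text \<open>
  The last row belongs to an empty row of \<open>\<mu>\<close>, so its entries are \<open>h\<^sub>k\<close> with \<open>k < 0\<close> and finally
  \<open>h\<^sub>0 = 1\<close>. Hence the order of the determinant can be raised to reach the number of rows of the
  diagram at which it is evaluated.
\<close>

lemma multi_schur_Suc:
  assumes \<mu>: "young_diagram \<mu>" and n: "num_rows \<mu> \<le> n"
  shows "multi_schur (Suc n) a \<mu> = multi_schur n a \<mu>"
proof -
  define A where "A = mat (Suc n) (Suc n) (\<lambda>(i, j).
     multi_h (shift (- int j) a) (int (row_len \<mu> (i + 1)) - int i + int j))"
  have A: "A \<in> carrier_mat (Suc n) (Suc n)" by (simp add: A_def)
  have "row_len \<mu> (n + 1) = 0"
    using n by (subst row_len_eq_0_iff[OF \<mu>]) auto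
  then have last: "A $$ (n, j) = (if j = n then 1 else 0)" if "j < Suc n" for j
    using that by (simp add: A_def)
  have "det A = (\<Sum>j<Suc n. A $$ (n, j) * cofactor A n j)"
    by (rule laplace_expansion_row[OF A]) simp
  also have "\<dots> = (\<Sum>j<Suc n. if j = n then cofactor A n n else 0)"
    by (rule sum.cong) (auto simp: last)
  also have "\<dots> = det (mat_delete A n n)"
    by (simp add: cofactor_def flip: mult_2)
  also have "mat_delete A n n = mat n n (\<lambda>(i, j).
     multi_h (shift (- int j) a) (int (row_len \<mu> (i + 1)) - int i + int j))"
    by (rule eq_matI) (auto simp: mat_delete_def A_def)
  finally show ?thesis by (simp add: multi_schur_def A_def)
qed

lemma multi_schur_stable:
  assumes "young_diagram \<mu>" "num_rows \<mu> \<le> n" "n \<le> N"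
  shows "multi_schur N a \<mu> = multi_schur n a \<mu>"
  using assms(3)
proof (induction N rule: dec_induct)
  case (step N)
  then show ?case using multi_schur_Suc[OF assms(1), of N a] assms(2) by simp
qed simp

lemma multi_schur_eval:
  assumes \<nu>: "young_diagram \<nu>" and N: "num_rows \<nu> \<le> N"
  shows "diagram_eval a \<nu> (multi_schur N a \<mu>) =
    det (mat N N (\<lambda>(i, k). int_nth ((\<Prod>r\<in>{1 - int N..maya \<mu> i - 1}. lin (a r)) *
      inverse (\<Prod>t\<in>{k..<N}. lin (a (maya \<nu> t)))) (maya \<mu> i + int k)))"
proof -
  let ?h = "\<lambda>(i, j). multi_h (shift (- int j) a) (int (row_len \<mu> (i + 1)) - int i + int j)"
  have "diagram_eval a \<nu> (multi_schur N a \<mu>)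
      = det (map_mat (diagram_eval a \<nu>) (mat N N ?h))"
    by (simp add: multi_schur_def diagram_eval_eq)
  also have "map_mat (diagram_eval a \<nu>) (mat N N ?h) =
    mat N N (\<lambda>(i, j). int_nth ((\<Prod>t<j. lin (a (- int t))) *
      (\<Prod>r\<in>{1 - int N..maya \<mu> i - 1}. lin (a r)) * inverse (\<Prod>t<N. lin (a (maya \<nu> t)))) (maya \<mu> i + int j))"
  proof (rule eq_matI)
    fix i j assume "i < dim_row (mat N N (\<lambda>(i, j). int_nth ((\<Prod>t<j. lin (a (- int t))) *
      (\<Prod>r\<in>{1 - int N..maya \<mu> i - 1}. lin (a r)) * inverse (\<Prod>t<N. lin (a (maya \<nu> t)))) (maya \<mu> i + int j)))"
      and "j < dim_col (mat N N (\<lambda>(i, j). int_nth ((\<Prod>t<j. lin (a (- int t))) *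
      (\<Prod>r\<in>{1 - int N..maya \<mu> i - 1}. lin (a r)) * inverse (\<Prod>t<N. lin (a (maya \<nu> t)))) (maya \<mu> i + int j)))"
    then have ij: "i < N" "j < N" by simp_all
    have "?h (i, j) = multi_h (shift (- int j) a) (maya \<mu> i + int j)"
      by (simp add: maya_def)
    then show "map_mat (diagram_eval a \<nu>) (mat N N ?h) $$ (i, j) =
      mat N N (\<lambda>(i, j). int_nth ((\<Prod>t<j. lin (a (- int t))) *
      (\<Prod>r\<in>{1 - int N..maya \<mu> i - 1}. lin (a r)) * inverse (\<Prod>t<N. lin (a (maya \<nu> t)))) (maya \<mu> i + int j)) $$ (i, j)"
      using ij by (simp add: multi_h_eval[OF \<nu> N])
  qed simp_all
  also have "det \<dots> = det (mat N N (\<lambda>(i, k). int_nth ((\<Prod>r\<in>{1 - int N..maya \<mu> i - 1}. lin (a r)) *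
      inverse (\<Prod>t\<in>{k..<N}. lin (a (maya \<nu> t)))) (maya \<mu> i + int k)))"
    by (rule det_newton_change)
  finally show ?thesis .
qed

text \<open>
  If row \<open>s + 1\<close> of \<open>\<mu>\<close> is longer than that of \<open>\<nu>\<close>, then \<open>maya \<mu> i > maya \<nu> k\<close> for all
  \<open>i \<le> s \<le> k\<close>, because both sequences decrease. This gives the block of zeros.
\<close>

lemma multi_schur_vanishes:
  assumes \<mu>: "young_diagram \<mu>" and \<nu>: "young_diagram \<nu>" and n: "num_rows \<mu> \<le> n"
    and not_sub: "\<not> \<mu> \<subseteq> \<nu>"
  shows "diagram_eval a \<nu> (multi_schur n a \<mu>) = 0"
proof -
  define N where "N = max n (num_rows \<nu>)"
  obtain i j where ij: "(i, j) \<in> \<mu>" "(i, j) \<notin> \<nu>" using not_sub by auto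
  define s where "s = i - 1"
  have i: "i = s + 1" using diagram_ge_1[OF \<mu> ij(1)] by (simp add: s_def)
  have less: "row_len \<nu> (s + 1) < row_len \<mu> (s + 1)"
    using ij in_diagram_iff_row[OF \<mu>, of i j] in_diagram_iff_row[OF \<nu>, of i j] by (simp add: i)
  then have "s < N"
    using row_len_eq_0_iff[OF \<mu>, of "s + 1"] n by (simp add: N_def)
  have "maya \<nu> k < maya \<mu> i'" if "i' \<le> s" "s \<le> k" for i' k
    using less row_len_antimono[OF \<mu>, of "i' + 1" "s + 1"] row_len_antimono[OF \<nu>, of "s + 1" "k + 1"] that
    by (simp add: maya_def)
  then have "diagram_eval a \<nu> (multi_schur N a \<mu>) = 0"
    by (subst multi_schur_eval[OF \<nu>], simp add: N_def, intro det_zero_block[OF _ \<open>s < N\<close>])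
       (simp_all add: newton_entry_eq_0[OF \<nu>])
  then show ?thesis
    using multi_schur_stable[OF \<mu> n, of N a] by (simp add: N_def)
qed

lemma multi_schur_eval_self:
  assumes \<mu>: "young_diagram \<mu>" and n: "num_rows \<mu> \<le> n"
  shows "diagram_eval a \<mu> (multi_schur n a \<mu>) =
    (\<Prod>(i, j)\<in>\<mu>. a (int (row_len \<mu> i) - int i + 1) - a (int j - int (col_len \<mu> j)))"
proof -
  define A where "A = mat n n (\<lambda>(i, k). int_nth ((\<Prod>r\<in>{1 - int n..maya \<mu> i - 1}. lin (a r)) *
      inverse (\<Prod>t\<in>{k..<n}. lin (a (maya \<mu> t)))) (maya \<mu> i + int k))"
  have "det A = prod_list (diag_mat A)"
  proof (rule det_lower_triangular[of n])
    fix i k assume "i < k" "k < n"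
    then show "A $$ (i, k) = 0"
      using newton_entry_eq_0[OF \<mu> _ maya_strict_antimono[OF \<mu>]] by (simp add: A_def)
  qed (simp add: A_def)
  also have "\<dots> = (\<Prod>i<n. \<Prod>j\<in>{1..row_len \<mu> (i + 1)}. a (maya \<mu> i) - a (gap \<mu> j))"
    unfolding prod_list_diag_prod
    by (rule prod.cong) (simp_all add: A_def newton_entry_diag[OF \<mu> n _ refl] atLeast0LessThan)
  also have "\<dots> = (\<Prod>(i, j)\<in>\<mu>. a (int (row_len \<mu> i) - int i + 1) - a (int j - int (col_len \<mu> j)))"
    unfolding prod_diagram[OF \<mu> n] by (simp add: maya_def gap_def algebra_simps)
  finally show ?thesis
    by (simp add: multi_schur_eval[OF \<mu> n] A_def)
qed

text \<open>
  The two indices differ by the hook length \<open>(\<mu>\<^sub>i - j) + (\<mu>'\<^sub>j - i) + 1\<close>, which is positive.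
\<close>

lemma interpolation_value_nonzero:
  fixes a :: "int \<Rightarrow> complex"
  assumes "inj a" and \<mu>: "young_diagram \<mu>"
  shows "(\<Prod>(i, j)\<in>\<mu>. a (int (row_len \<mu> i) - int i + 1) - a (int j - int (col_len \<mu> j))) \<noteq> 0"
proof -
  have "a (int (row_len \<mu> i) - int i + 1) \<noteq> a (int j - int (col_len \<mu> j))" if "(i, j) \<in> \<mu>" for i j
  proof -
    have "j \<le> row_len \<mu> i" "i \<le> col_len \<mu> j"
      using that in_diagram_iff_row[OF \<mu>] in_diagram_iff_col[OF \<mu>] by blast+
    then have "int (row_len \<mu> i) - int i + 1 \<noteq> int j - int (col_len \<mu> j)" by simp
    then show ?thesis using injD[OF \<open>inj a\<close>] by blast
  qed
  then show ?thesis
    unfolding prod_zero_iff[OF diagram_finite[OF \<mu>]] by auto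
qed

section \<open>Degrees\<close>

definition deg_le :: "sym_fun \<Rightarrow> nat \<Rightarrow> bool" where
  "deg_le f d \<longleftrightarrow> (\<forall>m\<in>Poly_Mapping.keys f. mono_degree m \<le> d)"

lemma sym_degree_le_iff: "sym_degree f \<le> d \<longleftrightarrow> deg_le f d"
  by (simp add: sym_degree_def deg_le_def)

lemma mono_degree_add: "mono_degree (m + n) = mono_degree m + mono_degree n"
proof -
  have superset: "mono_degree p = (\<Sum>i\<in>S. (i + 1) * Poly_Mapping.lookup p i)"
    if "finite S" "Poly_Mapping.keys p \<subseteq> S" for p S
    unfolding mono_degree_def
    by (rule sum.mono_neutral_left) (use that in \<open>auto simp: in_keys_iff\<close>)
  let ?S = "Poly_Mapping.keys m \<union> Poly_Mapping.keys n"
  have "mono_degree (m + n) = (\<Sum>i\<in>?S. (i + 1) * Poly_Mapping.lookup (m + n) i)"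
    by (rule superset) (simp_all add: Poly_Mapping.keys_add)
  also have "\<dots> = (\<Sum>i\<in>?S. (i + 1) * Poly_Mapping.lookup m i) + (\<Sum>i\<in>?S. (i + 1) * Poly_Mapping.lookup n i)"
    by (simp only: lookup_add distrib_left sum.distrib)
  also have "\<dots> = mono_degree m + mono_degree n"
    by (subst (1 2) superset[of ?S]) auto
  finally show ?thesis .
qed

lemma deg_le_mono: "deg_le f d \<Longrightarrow> d \<le> e \<Longrightarrow> deg_le f e"
  by (auto simp: deg_le_def)

lemma deg_le_0 [simp]: "deg_le 0 d"
  by (simp add: deg_le_def)

lemma deg_le_const [simp]: "deg_le (sym_const c) d"
  by (simp add: deg_le_def sym_const_def mono_degree_def)

lemma deg_le_1 [simp]: "deg_le 1 d"
  using deg_le_const[of 1] by simp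

lemma deg_le_power_sum: "1 \<le> k \<Longrightarrow> deg_le (power_sum k) k"
  by (simp add: deg_le_def power_sum_def mono_degree_def)

lemma deg_le_add: "deg_le f d \<Longrightarrow> deg_le g d \<Longrightarrow> deg_le (f + g) d"
  using Poly_Mapping.keys_add[of f g] by (auto simp: deg_le_def)

lemma deg_le_uminus: "deg_le f d \<Longrightarrow> deg_le (- f) d"
  by (auto simp: deg_le_def in_keys_iff)

lemma deg_le_sum: "(\<And>i. i \<in> I \<Longrightarrow> deg_le (f i) d) \<Longrightarrow> deg_le (\<Sum>i\<in>I. f i) d"
  by (induction I rule: infinite_finite_induct) (simp_all add: deg_le_add)

lemma deg_le_mult:
  assumes "deg_le f d" "deg_le g e" shows "deg_le (f * g) (d + e)"
  unfolding deg_le_def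
proof
  fix m assume "m \<in> Poly_Mapping.keys (f * g)"
  then obtain p q where "m = p + q" "p \<in> Poly_Mapping.keys f" "q \<in> Poly_Mapping.keys g"
    using keys_mult[of f g] by blast
  then show "mono_degree m \<le> d + e"
    using assms by (auto simp: deg_le_def mono_degree_add intro!: add_mono)
qed

lemma deg_le_prod:
  "(\<And>i. i \<in> I \<Longrightarrow> deg_le (f i) (d i)) \<Longrightarrow> deg_le (\<Prod>i\<in>I. f i) (\<Sum>i\<in>I. d i)"
  by (induction I rule: infinite_finite_induct) (simp_all add: deg_le_mult)

text \<open>
  Total degree at most 0 when \<open>u\<close> has degree 1. Products preserve this condition, so it passes from
  the exponent in the definition of \<open>H(u)\<close> to \<open>H(u)\<close> itself.
\<close>

definition graded :: "sym_fun fps \<Rightarrow> bool" where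
  "graded F \<longleftrightarrow> (\<forall>k. deg_le (fps_nth F k) k)"

lemma graded_mult: "graded F \<Longrightarrow> graded G \<Longrightarrow> graded (F * G)"
  unfolding graded_def
proof
  fix k assume FG: "\<forall>k. deg_le (fps_nth F k) k" "\<forall>k. deg_le (fps_nth G k) k"
  have "deg_le (fps_nth F i * fps_nth G (k - i)) k" if "i \<in> {0..k}" for i
    using deg_le_mult[of "fps_nth F i" i "fps_nth G (k - i)" "k - i"] FG that by simp
  then show "deg_le (fps_nth (F * G) k) k"
    unfolding fps_mult_nth by (rule deg_le_sum)
qed

lemma graded_lift: "graded (fps_lift F)"
  by (simp add: graded_def fps_lift_def)

lemma graded_power: "graded F \<Longrightarrow> graded (F ^ i)"
proof (induction i)
  case 0 then show ?case by (simp add: graded_def)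
next
  case (Suc i) then show ?case by (simp add: graded_mult)
qed

lemma graded_compose:
  assumes "graded F" shows "graded (fps_lift G oo F)"
proof -
  have "deg_le (sym_const c * fps_nth (F ^ i) k) k" for c i k
    using deg_le_mult[OF deg_le_const, of "fps_nth (F ^ i) k" k c 0] graded_power[OF assms]
    by (simp add: graded_def)
  then show ?thesis
    unfolding graded_def fps_compose_nth by (intro allI deg_le_sum) (simp add: fps_lift_def)
qed

lemma graded_H_series: "graded H_series"
  unfolding H_series_def
proof (rule graded_compose)
  have "deg_le (sym_const c * power_sum k) k" if "k \<noteq> 0" for c k
    using deg_le_mult[OF deg_le_const deg_le_power_sum, of k c 0] that by simp
  then show "graded (Abs_fps (\<lambda>k. if k = 0 then 0 else sym_const (1 / of_nat k) * power_sum k))"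
    by (simp add: graded_def)
qed

lemma deg_le_multi_h: "deg_le (multi_h a k) (nat k)"
proof (cases "k < 0")
  case False
  then obtain l where "k = int l" by (metis nonneg_int_cases not_less)
  then show ?thesis
    using graded_mult[OF graded_H_series graded_lift] by (simp add: multi_h_eq_nth graded_def)
qed simp

text \<open>
  In the term of a permutation \<open>p\<close> the degrees are bounded by \<open>\<mu>\<^sub>i - i + p(i)\<close>, and these numbers
  add up to \<open>|\<mu>|\<close>. A negative one among them makes the term 0, so that the truncation in the degree
  bound of \<open>h\<^sub>k\<close> does no harm.
\<close>

lemma deg_le_multi_schur:
  assumes \<mu>: "young_diagram \<mu>" and n: "num_rows \<mu> \<le> n"
  shows "deg_le (multi_schur n a \<mu>) (card \<mu>)"
proof -
  define A where "A = mat n n (\<lambda>(i, j).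
     multi_h (shift (- int j) a) (int (row_len \<mu> (i + 1)) - int i + int j))"
  have A: "A \<in> carrier_mat n n" by (simp add: A_def)
  have "deg_le (signof p * (\<Prod>i = 0..<n. A $$ (i, p i))) (card \<mu>)" if p: "p permutes {0..<n}" for p
  proof -
    define e where "e i = int (row_len \<mu> (i + 1)) - int i + int (p i)" for i
    have entry: "A $$ (i, p i) = multi_h (shift (- int (p i)) a) (e i)" if "i \<in> {0..<n}" for i
      using that permutes_in_image[OF p, of i] by (simp add: A_def e_def)
    have "deg_le (\<Prod>i = 0..<n. A $$ (i, p i)) (card \<mu>)"
    proof (cases "\<forall>i\<in>{0..<n}. 0 \<le> e i")
      case True
      have "(\<Sum>i = 0..<n. int (p i)) = (\<Sum>i = 0..<n. int i)"
        by (rule sum.permute[OF p, of int, unfolded o_def, symmetric])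
      then have "(\<Sum>i = 0..<n. e i) = int (\<Sum>i<n. row_len \<mu> (i + 1))"
        by (simp add: e_def sum.distrib sum_subtractf atLeast0LessThan)
      then have "int (\<Sum>i = 0..<n. nat (e i)) = int (card \<mu>)"
        using True card_diagram[OF \<mu> n] by simp
      moreover have "deg_le (\<Prod>i = 0..<n. A $$ (i, p i)) (\<Sum>i = 0..<n. nat (e i))"
        by (rule deg_le_prod) (simp add: entry deg_le_multi_h)
      ultimately show ?thesis by (simp only: of_nat_eq_iff)
    next
      case False
      then obtain i where i: "i \<in> {0..<n}" "e i < 0" by force
      then have "A $$ (i, p i) = 0" by (simp add: entry)
      then have "(\<Prod>i = 0..<n. A $$ (i, p i)) = 0"
        using i(1) by (intro prod_zero bexI[of _ i]) simp_all
      then show ?thesis by (simp only: deg_le_0)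
    qed
    then show ?thesis by (auto simp: sign_def deg_le_uminus)
  qed
  then have "deg_le (det A) (card \<mu>)"
    unfolding det_def'[OF A] by (intro deg_le_sum) simp
  then show ?thesis by (simp add: multi_schur_def A_def)
qed

section \<open>Elements that vanish on all small diagrams\<close>

text \<open>
  By triangularity the \<open>s i\<close> are linearly independent. A nonzero \<open>f\<close> on which all functionals vanish
  could be added to them, giving an independent set that is larger than the spanning set \<open>T\<close>.
\<close>

lemma (in vector_space) eq_0_if_triangular_functionals_vanish:
  fixes s :: "'i \<Rightarrow> 'b" and \<phi> :: "'i \<Rightarrow> 'b \<Rightarrow> 'a" and r :: "'i \<Rightarrow> nat"
  assumes fin: "finite I" "finite T" and card: "card T \<le> card I"
    and span: "s ` I \<subseteq> span T" "f \<in> span T"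
    and add: "\<And>i x y. \<phi> i (x + y) = \<phi> i x + \<phi> i y"
    and scale: "\<And>i c x. \<phi> i (c *s x) = c * \<phi> i x"
    and zero: "\<And>i j. i \<in> I \<Longrightarrow> j \<in> I \<Longrightarrow> i \<noteq> j \<Longrightarrow> r i \<le> r j \<Longrightarrow> \<phi> i (s j) = 0"
    and diag: "\<And>i. i \<in> I \<Longrightarrow> \<phi> i (s i) \<noteq> 0"
    and f: "\<And>i. i \<in> I \<Longrightarrow> \<phi> i f = 0"
  shows "f = 0"
proof (rule ccontr)
  assume "f \<noteq> 0"
  have \<phi>0: "\<phi> i 0 = 0" for i using scale[of i 0 0] by simp
  have \<phi>sum: "\<phi> i (\<Sum>x\<in>X. g x) = (\<Sum>x\<in>X. \<phi> i (g x))" for i X and g :: "'i \<Rightarrow> 'b"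
    by (induction X rule: infinite_finite_induct) (simp_all add: \<phi>0 add)
  have inj: "inj_on s I"
  proof (rule inj_onI)
    fix i j assume ij: "i \<in> I" "j \<in> I" "s i = s j"
    show "i = j"
    proof (rule ccontr)
      assume "i \<noteq> j"
      then show False
        using zero[of i j] zero[of j i] diag[of i] diag[of j] ij by (cases "r i \<le> r j") simp_all
    qed
  qed
  have notin: "f \<notin> s ` I" using f diag by auto
  have "independent (insert f (s ` I))"
  proof (rule independent_if_scalars_zero)
    fix g x assume "(\<Sum>x\<in>insert f (s ` I). g x *s x) = 0" and x: "x \<in> insert f (s ` I)"
    then have sum: "g f *s f + (\<Sum>i\<in>I. g (s i) *s s i) = 0"
      using fin notin by (simp add: sum.reindex[OF inj] o_def)
    have gs: "g (s i) = 0" if "i \<in> I" for i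
      using that
    proof (induction "r i" arbitrary: i rule: less_induct)
      case less
      have "0 = \<phi> i (g f *s f + (\<Sum>i\<in>I. g (s i) *s s i))" using sum \<phi>0 by simp
      also have "\<dots> = (\<Sum>j\<in>I. g (s j) * \<phi> i (s j))"
        using f[OF less.prems] by (simp add: add scale \<phi>sum)
      also have "\<dots> = (\<Sum>j\<in>I. if j = i then g (s i) * \<phi> i (s i) else 0)"
      proof (rule sum.cong)
        fix j assume "j \<in> I"
        then show "g (s j) * \<phi> i (s j) = (if j = i then g (s i) * \<phi> i (s i) else 0)"
          using less zero[of i j] by (cases "r i \<le> r j") auto
      qed simp
      also have "\<dots> = g (s i) * \<phi> i (s i)" using fin less.prems by simp
      finally show ?case using diag[OF less.prems] by simp
    qed
    then have "g f *s f = 0" using sum by simp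
    then have "g f = 0" using \<open>f \<noteq> 0\<close> by simp
    then show "g x = 0" using gs x by auto
  qed (use fin in simp)
  moreover have "insert f (s ` I) \<subseteq> span T" using span by simp
  ultimately have "card (insert f (s ` I)) \<le> card T"
    using independent_span_bound[OF fin(2)] by blast
  then show False using card notin fin by (simp add: card_image[OF inj])
qed

text \<open>
  The diagram with \<open>m\<^sub>k\<close> rows of length \<open>k + 1\<close>, where \<open>m\<^sub>k\<close> is the exponent of the generator
  \<open>p\<^bsub>k+1\<^esub>\<close>. The sum is the number of rows of length at least \<open>j\<close>, so columns rather than rows are
  prescribed and no sorting is needed.
\<close>

definition diagram_of_exponents :: "(nat \<Rightarrow>\<^sub>0 nat) \<Rightarrow> (nat \<times> nat) set" where
  "diagram_of_exponents m = {(i, j). 1 \<le> i \<and> 1 \<le> j \<and>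
     i \<le> (\<Sum>k\<in>{k\<in>Poly_Mapping.keys m. j \<le> k + 1}. Poly_Mapping.lookup m k)}"

lemma col_len_diagram_of_exponents:
  assumes "1 \<le> j"
  shows "col_len (diagram_of_exponents m) j
    = (\<Sum>k\<in>{k\<in>Poly_Mapping.keys m. j \<le> k + 1}. Poly_Mapping.lookup m k)"
proof -
  have "{i. (i, j) \<in> diagram_of_exponents m}
      = {1..\<Sum>k\<in>{k\<in>Poly_Mapping.keys m. j \<le> k + 1}. Poly_Mapping.lookup m k}"
    using assms by (auto simp: diagram_of_exponents_def)
  then show ?thesis by (simp add: col_len_def)
qed

lemma diagram_of_exponents_eq_Sigma:
  assumes "Poly_Mapping.keys m \<subseteq> {..<J}"
  shows "diagram_of_exponents m = prod.swap ` (SIGMA j:{1..J}. {1..col_len (diagram_of_exponents m) j})"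
proof (rule Set.set_eqI)
  fix x :: "nat \<times> nat"
  obtain i j where x: "x = (i, j)" by (cases x)
  have "(i, j) \<in> diagram_of_exponents m \<longleftrightarrow> 1 \<le> j \<and> 1 \<le> i \<and>
      i \<le> (\<Sum>k\<in>{k\<in>Poly_Mapping.keys m. j \<le> k + 1}. Poly_Mapping.lookup m k)"
    by (auto simp: diagram_of_exponents_def)
  then have "(i, j) \<in> diagram_of_exponents m \<longleftrightarrow>
      1 \<le> j \<and> 1 \<le> i \<and> i \<le> col_len (diagram_of_exponents m) j"
    using col_len_diagram_of_exponents[of j m] by auto
  moreover have "j \<le> J" if "1 \<le> j" "1 \<le> i" "i \<le> col_len (diagram_of_exponents m) j"
  proof (rule ccontr)
    assume "\<not> j \<le> J"
    then have "{k\<in>Poly_Mapping.keys m. j \<le> k + 1} = {}" using assms by auto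
    then have "col_len (diagram_of_exponents m) j = 0"
      using that(1) by (simp only: col_len_diagram_of_exponents sum.empty)
    then show False using that by simp
  qed
  ultimately show "x \<in> diagram_of_exponents m \<longleftrightarrow>
      x \<in> prod.swap ` (SIGMA j:{1..J}. {1..col_len (diagram_of_exponents m) j})"
    by (auto simp: image_iff x)
qed

lemma young_diagram_diagram_of_exponents: "young_diagram (diagram_of_exponents m)"
proof -
  obtain J where "Poly_Mapping.keys m \<subseteq> {..<J}"
    using finite_nat_iff_bounded[of "Poly_Mapping.keys m"] by auto
  then have "finite (diagram_of_exponents m)"
    by (subst diagram_of_exponents_eq_Sigma) auto
  moreover have "(i', j') \<in> diagram_of_exponents m"
    if "(i, j) \<in> diagram_of_exponents m" "1 \<le> i'" "i' \<le> i" "1 \<le> j'" "j' \<le> j" for i j i' j'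
  proof -
    have "(\<Sum>k\<in>{k\<in>Poly_Mapping.keys m. j \<le> k + 1}. Poly_Mapping.lookup m k)
        \<le> (\<Sum>k\<in>{k\<in>Poly_Mapping.keys m. j' \<le> k + 1}. Poly_Mapping.lookup m k)"
      by (rule sum_mono2) (use that in auto)
    then show ?thesis using that by (auto simp: diagram_of_exponents_def)
  qed
  moreover have "1 \<le> i \<and> 1 \<le> j" if "(i, j) \<in> diagram_of_exponents m" for i j
    using that by (simp add: diagram_of_exponents_def)
  ultimately show ?thesis
    unfolding young_diagram_def by blast
qed

lemma card_diagram_of_exponents: "card (diagram_of_exponents m) = mono_degree m"
proof -
  let ?l = "Poly_Mapping.lookup m" and ?K = "Poly_Mapping.keys m"
  obtain J where J: "?K \<subseteq> {..<J}"
    using finite_nat_iff_bounded[of ?K] by auto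
  have "card (diagram_of_exponents m)
      = card (SIGMA j:{1..J}. {1..col_len (diagram_of_exponents m) j})"
    by (subst diagram_of_exponents_eq_Sigma[OF J]) (simp add: card_image)
  also have "\<dots> = (\<Sum>j=1..J. col_len (diagram_of_exponents m) j)"
    by simp
  also have "\<dots> = (\<Sum>j=1..J. \<Sum>k\<in>{k\<in>?K. j \<le> k + 1}. ?l k)"
    by (rule sum.cong) (simp_all add: col_len_diagram_of_exponents)
  also have "\<dots> = (\<Sum>k\<in>?K. \<Sum>j\<in>{j\<in>{1..J}. j \<le> k + 1}. ?l k)"
    by (rule sum.swap_restrict) auto
  also have "\<dots> = (\<Sum>k\<in>?K. (k + 1) * ?l k)"
  proof (rule sum.cong)
    fix k assume "k \<in> ?K"
    then have "{j\<in>{1..J}. j \<le> k + 1} = {1..k + 1}" using J by auto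
    then show "(\<Sum>j\<in>{j\<in>{1..J}. j \<le> k + 1}. ?l k) = (k + 1) * ?l k" by simp
  qed simp
  finally show ?thesis by (simp add: mono_degree_def)
qed

text \<open>
  The number of rows of length \<open>k + 1\<close> is the difference of two consecutive column lengths.
\<close>

lemma inj_diagram_of_exponents: "inj diagram_of_exponents"
proof (rule injI, rule poly_mapping_eqI)
  fix m n k assume eq: "diagram_of_exponents m = diagram_of_exponents n"
  have "col_len (diagram_of_exponents p) (k + 1)
      = Poly_Mapping.lookup p k + col_len (diagram_of_exponents p) (k + 2)" for p
  proof (cases "k \<in> Poly_Mapping.keys p")
    case True
    then have "{l\<in>Poly_Mapping.keys p. k + 1 \<le> l + 1} = insert k {l\<in>Poly_Mapping.keys p. k + 2 \<le> l + 1}"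
      by auto
    then show ?thesis by (simp add: col_len_diagram_of_exponents)
  next
    case False
    then have "{l\<in>Poly_Mapping.keys p. k + 1 \<le> l + 1} = {l\<in>Poly_Mapping.keys p. k + 2 \<le> l + 1}"
      by (auto simp: le_less Suc_le_eq)
    moreover have "Poly_Mapping.lookup p k = 0" using False by (simp add: in_keys_iff)
    ultimately show ?thesis by (simp only: col_len_diagram_of_exponents)
  qed
  from this[of m] this[of n] show "Poly_Mapping.lookup m k = Poly_Mapping.lookup n k"
    using eq by simp
qed

definition diagrams_upto :: "nat \<Rightarrow> (nat \<times> nat) set set" where
  "diagrams_upto d = {\<nu>. young_diagram \<nu> \<and> card \<nu> \<le> d}"

lemma finite_diagrams_upto: "finite (diagrams_upto d)"
proof (rule finite_subset)
  show "diagrams_upto d \<subseteq> Pow ({1..d} \<times> {1..d})"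
  proof (rule subsetI, rule PowI, rule subsetI, clarify)
    fix \<nu> i j assume "\<nu> \<in> diagrams_upto d" and ij: "(i, j) \<in> \<nu>"
    then have \<nu>: "young_diagram \<nu>" "card \<nu> \<le> d" by (auto simp: diagrams_upto_def)
    have "{1..i} \<times> {1..j} \<subseteq> \<nu>" using diagram_down[OF \<nu>(1) ij] by auto
    then have "card ({1..i} \<times> {1..j}) \<le> card \<nu>"
      by (rule card_mono[OF diagram_finite[OF \<nu>(1)]])
    then have ij_le: "i * j \<le> d" using \<nu>(2) by simp
    have pos: "1 \<le> i" "1 \<le> j" using diagram_ge_1[OF \<nu>(1) ij] by simp_all
    have "i \<le> i * j" "j \<le> i * j"
      using pos by simp_all
    then have "i \<le> d" "j \<le> d" using ij_le by linarith+
    then show "i \<in> {1..d} \<and> j \<in> {1..d}" using pos by simp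
  qed
qed simp

lemma exponents_upto:
  "finite {m. mono_degree m \<le> d}" "card {m. mono_degree m \<le> d} \<le> card (diagrams_upto d)"
proof -
  have sub: "diagram_of_exponents ` {m. mono_degree m \<le> d} \<subseteq> diagrams_upto d"
    by (auto simp: diagrams_upto_def young_diagram_diagram_of_exponents card_diagram_of_exponents)
  have inj: "inj_on diagram_of_exponents {m. mono_degree m \<le> d}"
    using inj_diagram_of_exponents by (rule inj_on_subset) simp
  show "finite {m. mono_degree m \<le> d}"
    using inj_on_finite[OF inj sub finite_diagrams_upto] .
  show "card {m. mono_degree m \<le> d} \<le> card (diagrams_upto d)"
    using card_inj_on_le[OF inj sub finite_diagrams_upto] .
qed

interpretation sym_fun: vector_space "\<lambda>c (f :: sym_fun). sym_const c * f"
proof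
  fix c d :: complex and f g :: sym_fun
  show "sym_const c * (f + g) = sym_const c * f + sym_const c * g"
    by (rule distrib_left)
  show "sym_const (c + d) * f = sym_const c * f + sym_const d * f"
    unfolding sym_const_add by (rule distrib_right)
  show "sym_const c * (sym_const d * f) = sym_const (c * d) * f"
    unfolding sym_const_mult by (rule mult.assoc[symmetric])
  show "sym_const 1 * f = f"
    unfolding sym_const_1 by (rule mult_1_left)
qed

lemma deg_le_in_span:
  assumes "deg_le f d"
  shows "f \<in> sym_fun.span ((\<lambda>m. Poly_Mapping.single m 1) ` {m. mono_degree m \<le> d})"
proof -
  have single: "sym_const c * Poly_Mapping.single m 1 = Poly_Mapping.single m c" for c m
    by (simp add: sym_const_def mult_single)
  have "(\<Sum>m\<in>Poly_Mapping.keys f. sym_const (Poly_Mapping.lookup f m) * Poly_Mapping.single m 1)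
      \<in> sym_fun.span ((\<lambda>m. Poly_Mapping.single m 1) ` {m. mono_degree m \<le> d})"
    using assms by (intro sym_fun.span_sum sym_fun.span_scale sym_fun.span_base) (auto simp: deg_le_def)
  then show ?thesis
    by (simp only: single flip: sum_monomials)
qed

lemma eq_0_if_vanishes_on_diagrams:
  assumes a: "inj a" and deg: "deg_le f d"
    and f: "\<And>\<nu>. young_diagram \<nu> \<Longrightarrow> card \<nu> \<le> d \<Longrightarrow> diagram_eval a \<nu> f = 0"
  shows "f = 0"
proof (rule sym_fun.eq_0_if_triangular_functionals_vanish)
  let ?T = "(\<lambda>m. Poly_Mapping.single m 1) ` {m. mono_degree m \<le> d} :: sym_fun set"
  let ?s = "\<lambda>\<nu>. multi_schur (num_rows \<nu>) a \<nu>"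
  show "finite (diagrams_upto d)" by (rule finite_diagrams_upto)
  show "finite ?T" using exponents_upto(1) by simp
  show "card ?T \<le> card (diagrams_upto d)"
    using card_image_le[OF exponents_upto(1)] exponents_upto(2) by (rule le_trans)
  show "?s ` diagrams_upto d \<subseteq> sym_fun.span ?T"
  proof clarify
    fix \<nu> assume "\<nu> \<in> diagrams_upto d"
    then have "deg_le (?s \<nu>) d"
      using deg_le_multi_schur[of \<nu> "num_rows \<nu>" a] by (auto simp: diagrams_upto_def intro: deg_le_mono)
    then show "?s \<nu> \<in> sym_fun.span ?T" by (rule deg_le_in_span)
  qed
  show "f \<in> sym_fun.span ?T" using deg by (rule deg_le_in_span)
  show "diagram_eval a \<nu> (g + h) = diagram_eval a \<nu> g + diagram_eval a \<nu> h" for \<nu> g h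
    by (simp add: diagram_eval_eq sym_subst_add)
  show "diagram_eval a \<nu> (sym_const c * g) = c * diagram_eval a \<nu> g" for \<nu> c g
    by (simp add: diagram_eval_eq sym_subst_mult)
  show "diagram_eval a \<nu> (?s \<mu>) = 0"
    if "\<nu> \<in> diagrams_upto d" "\<mu> \<in> diagrams_upto d" "\<nu> \<noteq> \<mu>" "card \<nu> \<le> card \<mu>" for \<nu> \<mu>
  proof (rule multi_schur_vanishes)
    show "young_diagram \<mu>" "young_diagram \<nu>" using that by (auto simp: diagrams_upto_def)
    then show "\<not> \<mu> \<subseteq> \<nu>" using that card_seteq[OF diagram_finite] by blast
  qed simp
  show "diagram_eval a \<nu> (?s \<nu>) \<noteq> 0" if "\<nu> \<in> diagrams_upto d" for \<nu>
    using that interpolation_value_nonzero[OF a, of \<nu>] by (simp add: diagrams_upto_def multi_schur_eval_self)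
  show "diagram_eval a \<nu> f = 0" if "\<nu> \<in> diagrams_upto d" for \<nu>
    using that f by (simp add: diagrams_upto_def)
qed

section \<open>Characterization of multiparameter Schur functions\<close>

theorem theorem5p6:
  fixes a :: "int \<Rightarrow> complex" and \<mu> :: "(nat \<times> nat) set" and n :: nat
  assumes "inj a"
    and "young_diagram \<mu>"
    and "n \<ge> num_rows \<mu>"
  shows "\<forall>f :: sym_fun. f = multi_schur n a \<mu> \<longleftrightarrow>
    sym_degree f \<le> card \<mu> \<and>
    diagram_eval a \<mu> f =
      (\<Prod>(i, j)\<in>\<mu>. a (int (row_len \<mu> i) - int i + 1) - a (int j - int (col_len \<mu> j))) \<and>
    (\<forall>\<nu>. young_diagram \<nu> \<and> card \<nu> \<le> card \<mu> \<and> \<nu> \<noteq> \<mu> \<longrightarrow> diagram_eval a \<nu> f = 0)"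
    (is "\<forall>f. f = ?s \<longleftrightarrow> ?P f")
proof -
  have P: "?P ?s"
  proof (intro conjI allI impI)
    show "sym_degree ?s \<le> card \<mu>"
      using deg_le_multi_schur[OF assms(2,3)] by (simp add: sym_degree_le_iff)
    show "diagram_eval a \<mu> ?s =
        (\<Prod>(i, j)\<in>\<mu>. a (int (row_len \<mu> i) - int i + 1) - a (int j - int (col_len \<mu> j)))"
      by (rule multi_schur_eval_self[OF assms(2,3)])
    fix \<nu> assume "young_diagram \<nu> \<and> card \<nu> \<le> card \<mu> \<and> \<nu> \<noteq> \<mu>"
    then show "diagram_eval a \<nu> ?s = 0"
      using card_seteq[OF diagram_finite, of \<nu> \<mu>] by (intro multi_schur_vanishes assms) auto
  qed
  have "f = ?s" if f: "?P f" for f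
  proof -
    have "f - ?s = 0"
    proof (rule eq_0_if_vanishes_on_diagrams[OF assms(1)])
      have "deg_le f (card \<mu>)" "deg_le ?s (card \<mu>)"
        using f P by (simp_all only: sym_degree_le_iff)
      then show "deg_le (f - ?s) (card \<mu>)"
        using deg_le_add[OF _ deg_le_uminus, of f "card \<mu>" ?s] by simp
      fix \<nu> assume "young_diagram \<nu>" "card \<nu> \<le> card \<mu>"
      then have "diagram_eval a \<nu> f = diagram_eval a \<nu> ?s"
        using f P by (cases "\<nu> = \<mu>") auto
      then show "diagram_eval a \<nu> (f - ?s) = 0"
        by (simp add: diagram_eval_eq sym_subst.hom_minus)
    qed
    then show ?thesis by simp
  qed
  with P show ?thesis by blast
qed

end
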